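(* Let $M$ be a $2$-regular $0,1$ matrix of dimensions $n \times n$. Then $M$ is equal, up to permutations of rows and columns, to a $(2;n_1, \ldots,n_m)$ circulant block diagonal matrix for some integers $m \geq 1$ and $n_1,\ldots,n_m \geq 2$. Let $m_2$ denote the number of indices $i \in [m]$ with $n_i=2$, and let $m_{even}$ denote the number of indices $i \in [m]$ for which $n_i$ is even. Unless $M$ is the all-one $2 \times 2$ matrix, it holds that \[\mathrm{rank}_{\mathrm{bin}}(M) = n-m_2\quad\text{and}\quad\mathrm{rank}_{\mathrm{bin}}(\overline{M}) \in \{n-m_{even}, n-m_{even}+1\}.\]
   Context: A square $0,1$ matrix is $k$-regular if every row and every column has precisely $k$ ones. For integers $n \ge k \ge 0$, $D_{n,k}$ denotes the $n\times n$ circulant $0,1$ matrix whose first row consists of $n-k$ ones followed by $k$ zeros, each subsequent row being the cyclic shift of the previous row by one position to the right. For integers $n_i\ge 2$, a $(2;n_1,\ldots,n_m)$ circulant block diagonal matrix is a block matrix with $m$ diagonal blocks whose $i$th diagonal block is $D_{n_i,n_i-2}$ (first row: two ones followed by $n_i-2$ zeros) and all of whose other entries are zero. $\overline{M}$ is the complement of $M$ (zeros and ones swapped). The binary rank $\mathrm{rank}_{\mathrm{bin}}(A)$ of a $0,1$ matrix $A$ is the smallest number of combinatorial rectangles (all-one submatrices indexed by a set of rows times a set of columns) that partition the ones of $A$ (equivalently, the smallest inner dimension of a factorization $A=A_1A_2$ over the reals with $0,1$ factors). *)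

theory Defs
  imports "Jordan_Normal_Form.Matrix" "HOL-Combinatorics.Permutations"
    "HOL-Library.Disjoint_Sets"
begin

definition zero_one_mat :: "real mat \<Rightarrow> bool" where
  "zero_one_mat A \<longleftrightarrow>
     (\<forall>i < dim_row A. \<forall>j < dim_col A. A $$ (i, j) = 0 \<or> A $$ (i, j) = 1)"

definition regular_mat :: "nat \<Rightarrow> real mat \<Rightarrow> bool" where
  "regular_mat k A \<longleftrightarrow> square_mat A \<and> zero_one_mat A \<and>
     (\<forall>i < dim_row A. card {j. j < dim_col A \<and> A $$ (i, j) = 1} = k) \<and>
     (\<forall>j < dim_col A. card {i. i < dim_row A \<and> A $$ (i, j) = 1} = k)"

text \<open>Row \<open>i\<close> is the first row shifted cyclically by \<open>i\<close> positions to the right, so its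
  entry in column \<open>j\<close> is the entry of the first row in column \<open>j - i\<close> modulo \<open>n\<close>;
  the summand \<open>n\<close> avoids truncated subtraction. Meant for \<open>k \<le> n\<close>.\<close>

definition circ_mat :: "nat \<Rightarrow> nat \<Rightarrow> real mat" where
  "circ_mat n k = mat n n (\<lambda>(i, j). if (n + j - i) mod n < n - k then 1 else 0)"

text \<open>The diagonal blocks for the list \<open>[n\<^sub>1, \<dots>, n\<^sub>m]\<close> of sizes; meant for sizes at least 2.\<close>

definition circ_block_diag2 :: "nat list \<Rightarrow> real mat" where
  "circ_block_diag2 ns = diag_block_mat (map (\<lambda>k. circ_mat k (k - 2)) ns)"

definition perm_equiv_mat :: "real mat \<Rightarrow> real mat \<Rightarrow> bool" where
  "perm_equiv_mat A B \<longleftrightarrow> dim_row A = dim_row B \<and> dim_col A = dim_col B \<and>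
     (\<exists>p q. p permutes {..<dim_row B} \<and> q permutes {..<dim_col B} \<and>
        A = mat (dim_row B) (dim_col B) (\<lambda>(i, j). B $$ (p i, q j)))"

definition compl_mat :: "real mat \<Rightarrow> real mat" where
  "compl_mat A = map_mat (\<lambda>x. 1 - x) A"

definition ones_of :: "real mat \<Rightarrow> (nat \<times> nat) set" where
  "ones_of A = {(i, j). i < dim_row A \<and> j < dim_col A \<and> A $$ (i, j) = 1}"

text \<open>A partition consists of nonempty, pairwise disjoint sets of positions with union
  \<^term>\<open>ones_of A\<close>, so every rectangle in it is an all-one submatrix. The partition into
  singletons shows that the minimum exists, and partitions of the finite set
  \<^term>\<open>ones_of A\<close> are finite, so \<^const>\<open>card\<close> is meaningful.\<close>

definition binary_rank :: "real mat \<Rightarrow> nat" where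
  "binary_rank A = (LEAST r. \<exists>P. partition_on (ones_of A) P \<and>
     (\<forall>R \<in> P. \<exists>I J. R = I \<times> J) \<and> card P = r)"

end

theory Submission
  imports Defs "Jordan_Normal_Form.Determinant" "HOL-Combinatorics.Cycles"
begin

text \<open>Rows and columns of a 2-regular matrix are the two sides of a bipartite graph, and moving
  alternately to the other one of the row and to the other one of the column traces out its
  components, which are cycles. Binary rank is additive over the cycles. A cycle with \<open>k > 2\<close> rows
  has \<open>2 * k\<close> ones and no rectangle with more than two of them, so its rank is \<open>k\<close>.

  For the complement, let \<open>p v = {v, succ v}\<close> be the columns of the ones in row \<open>v\<close>. In an even cycle
  the sets \<open>p v\<close> with \<open>v\<close> at even positions partition the cycle, and so do those at odd positions.
  Take as column sets the singletons of the odd cycles and, in each even cycle, all the \<open>p v\<close> except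
  that of the last (odd) position; the excluded sets of all the even cycles are united into a single
  extra column set. The complement of every \<open>p v\<close> is a disjoint union of such sets, which bounds the
  rank from above. From below it is bounded by the real rank: a vector killed by all rows of the
  complement alternates along each cycle (unless \<open>n = 2\<close>), so it vanishes if it has a zero in
  each even cycle.\<close>

section \<open>Tilings\<close>

text \<open>Unlike in \<^const>\<open>partition_on\<close>, one of the sets may be empty; this happens in
  \<open>corel_columns\<close> below when all cycles are odd.\<close>

definition tiles :: "'a set set \<Rightarrow> 'a set \<Rightarrow> bool" where
  "tiles \<B> S \<longleftrightarrow> disjoint \<B> \<and> \<Union>\<B> = S"

lemma tiles_Diff:
  assumes "tiles \<B> S" "\<R> \<subseteq> \<B>"
  shows "tiles (\<B> - \<R>) (S - \<Union>\<R>)"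
proof -
  have "disjoint (\<B> - \<R>)"
    using assms pairwise_subset[of disjnt \<B> "\<B> - \<R>"] by (simp add: tiles_def)
  moreover have "\<Union>(\<B> - \<R>) = S - \<Union>\<R>"
    using assms diff_Union_pairwise_disjoint[of \<B> \<R>] by (simp add: tiles_def)
  ultimately show ?thesis
    by (simp add: tiles_def)
qed

lemma tiles_merge:
  assumes "tiles \<B> S" "\<L> \<subseteq> \<B>"
  shows "tiles (insert (\<Union>\<L>) (\<B> - \<L>)) S"
proof -
  have rest: "tiles (\<B> - \<L>) (S - \<Union>\<L>)"
    using assms by (rule tiles_Diff)
  then have "disjnt (\<Union>\<L>) C" if "C \<in> \<B> - \<L>" for C
    using that by (auto simp: tiles_def disjnt_def)
  then have "disjoint (insert (\<Union>\<L>) (\<B> - \<L>))"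
    using rest by (simp add: tiles_def pairwise_insert disjnt_sym)
  moreover have "\<Union>\<L> \<union> \<Union>(\<B> - \<L>) = S"
    using assms by (auto simp: tiles_def)
  ultimately show ?thesis
    by (simp add: tiles_def)
qed

section \<open>Rectangle partitions of relations\<close>

definition rect_partition :: "('a \<times> 'b) set \<Rightarrow> ('a \<times> 'b) set set \<Rightarrow> bool" where
  "rect_partition E P \<longleftrightarrow> partition_on E P \<and> (\<forall>R\<in>P. \<exists>I J. R = I \<times> J)"

definition rect_rank :: "('a \<times> 'b) set \<Rightarrow> nat" where
  "rect_rank E = (LEAST r. \<exists>P. rect_partition E P \<and> card P = r)"

lemma binary_rank_eq_rect_rank: "binary_rank A = rect_rank (ones_of A)"
  by (simp add: binary_rank_def rect_rank_def rect_partition_def conj_assoc)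

lemma rect_partition_singletons: "rect_partition E ((\<lambda>e. {e}) ` E)"
proof -
  have "\<exists>I J. {e} = I \<times> J" for e :: "'a \<times> 'b"
    by (rule exI[of _ "{fst e}"], rule exI[of _ "{snd e}"]) auto
  then show ?thesis
    unfolding rect_partition_def using partition_on_singletons by blast
qed

lemma rect_rank_le: "rect_partition E P \<Longrightarrow> rect_rank E \<le> card P"
  unfolding rect_rank_def by (rule Least_le) blast

lemma rect_rank_attained:
  obtains P where "rect_partition E P" "card P = rect_rank E"
proof -
  have "\<exists>r P. rect_partition E P \<and> card P = r"
    using rect_partition_singletons by blast
  from LeastI_ex[OF this] show thesis
    using that unfolding rect_rank_def by blast
qed

lemma rect_partition_closed:
  assumes "rect_partition E P" "R \<in> P" "(v, w) \<in> R" "(v', w') \<in> R"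
  shows "(v, w') \<in> R"
proof -
  obtain I J where "R = I \<times> J"
    using assms(1,2) by (auto simp: rect_partition_def)
  then show ?thesis
    using assms(3,4) by simp
qed

lemma finite_rect_partition: "rect_partition E P \<Longrightarrow> finite E \<Longrightarrow> finite P"
  unfolding rect_partition_def using finite_elements by blast

lemma rect_partition_map_prod:
  assumes "rect_partition E P" "inj_on (map_prod f g) E"
  shows "rect_partition (map_prod f g ` E) ((`) (map_prod f g) ` P)"
proof -
  have P: "partition_on E P" and rect: "\<forall>R\<in>P. \<exists>I J. R = I \<times> J"
    using assms(1) by (auto simp: rect_partition_def)
  have "(`) (map_prod f g) ` P - {{}} = (`) (map_prod f g) ` P"
    using partition_onD3[OF P] by auto
  then have "partition_on (map_prod f g ` E) ((`) (map_prod f g) ` P)"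
    using partition_on_inj_image[OF P assms(2)] by simp
  moreover have "\<forall>R\<in>P. \<exists>I J. map_prod f g ` R = I \<times> J"
    using rect by (metis map_prod_surj_on)
  ultimately show ?thesis
    by (simp add: rect_partition_def)
qed

lemma rect_rank_map_prod_le:
  assumes "inj_on (map_prod f g) E"
  shows "rect_rank (map_prod f g ` E) \<le> rect_rank E"
proof -
  obtain P where P: "rect_partition E P" "card P = rect_rank E"
    by (rule rect_rank_attained)
  have "inj_on ((`) (map_prod f g)) P"
    using P(1) assms unfolding rect_partition_def by (metis inj_on_image partition_onD1)
  then show ?thesis
    using rect_rank_le[OF rect_partition_map_prod[OF P(1) assms]] P(2) by (simp add: card_image)
qed

lemma rect_rank_map_prod:
  assumes "inj_on f A" "inj_on g B" "E \<subseteq> A \<times> B"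
  shows "rect_rank (map_prod f g ` E) = rect_rank E"
proof (rule antisym)
  have inj: "inj_on (map_prod f g) (A \<times> B)"
    using assms(1,2) by (rule map_prod_inj_on)
  then show "rect_rank (map_prod f g ` E) \<le> rect_rank E"
    using assms(3) by (blast intro: rect_rank_map_prod_le inj_on_subset)
  let ?h = "map_prod (inv_into A f) (inv_into B g)"
  have "?h ` map_prod f g ` E = (\<lambda>e. e) ` E"
    unfolding image_image using assms by (intro image_cong) auto
  moreover have "inj_on ?h (map_prod f g ` E)"
    using assms(3)
    by (intro inj_on_subset[OF map_prod_inj_on[OF inj_on_inv_into inj_on_inv_into]]) auto
  ultimately show "rect_rank E \<le> rect_rank (map_prod f g ` E)"
    using rect_rank_map_prod_le[of "inv_into A f" "inv_into B g" "map_prod f g ` E"] by simp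
qed

lemma rect_rank_le_row_tiles:
  assumes "finite \<C>" and tiles: "\<And>v. v \<in> Domain E \<Longrightarrow> \<exists>\<D>\<subseteq>\<C>. tiles \<D> (E `` {v})"
  shows "rect_rank E \<le> card \<C>"
proof -
  obtain \<D> where \<D>: "\<And>v. v \<in> Domain E \<Longrightarrow> \<D> v \<subseteq> \<C> \<and> disjoint (\<D> v) \<and> \<Union>(\<D> v) = E `` {v}"
    using tiles unfolding tiles_def by metis
  define R where "R C = {v \<in> Domain E. C \<in> \<D> v} \<times> C" for C
  have "partition_on E (R ` \<C> - {{}})"
  proof (rule partition_onI)
    have "(v, w) \<in> E \<longleftrightarrow> (\<exists>C\<in>\<C>. (v, w) \<in> R C)" for v w
      using \<D>[of v] by (auto simp: R_def)
    then have "E = \<Union>(R ` \<C>)"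
      by auto
    then show "\<Union>(R ` \<C> - {{}}) = E"
      by blast
    fix p q assume "p \<in> R ` \<C> - {{}}" "q \<in> R ` \<C> - {{}}" "p \<noteq> q"
    then obtain C D where CD: "p = R C" "q = R D" "C \<noteq> D"
      by blast
    have "C = D" if "(v, w) \<in> R C" "(v, w) \<in> R D" for v w
      using that \<D>[of v] disjointD[of "\<D> v" C D] by (auto simp: R_def)
    then show "disjnt p q"
      using CD by (auto simp: disjnt_def)
  qed simp
  then have "rect_partition E (R ` \<C> - {{}})"
    unfolding rect_partition_def R_def by blast
  then have "rect_rank E \<le> card (R ` \<C> - {{}})"
    by (rule rect_rank_le)
  also have "\<dots> \<le> card (R ` \<C>)"
    using \<open>finite \<C>\<close> by (intro card_mono) auto
  also have "\<dots> \<le> card \<C>"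
    using \<open>finite \<C>\<close> by (rule card_image_le)
  finally show ?thesis .
qed

lemma rect_rank_le_card_rows:
  assumes "finite E"
  shows "rect_rank E \<le> card ((\<lambda>v. E `` {v}) ` Domain E)"
proof (rule rect_rank_le_row_tiles)
  fix v assume "v \<in> Domain E"
  then show "\<exists>\<D>\<subseteq>(\<lambda>v. E `` {v}) ` Domain E. tiles \<D> (E `` {v})"
    by (intro exI[of _ "{E `` {v}}"]) (auto simp: tiles_def)
qed (use assms in \<open>simp add: finite_Domain\<close>)

lemma card_le_mult_rect_rank:
  assumes "finite E" and rect: "\<And>I J. I \<times> J \<subseteq> E \<Longrightarrow> card (I \<times> J) \<le> m"
  shows "card E \<le> m * rect_rank E"
proof -
  obtain P where P: "rect_partition E P" "card P = rect_rank E"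
    by (rule rect_rank_attained)
  have E: "E = \<Union>P"
    using P(1) unfolding rect_partition_def by (blast dest: partition_onD1)
  have "card E \<le> sum card P"
    unfolding E by (rule card_Union_le_sum_card)
  also have "\<dots> \<le> card P * m"
  proof -
    have "card R \<le> m" if "R \<in> P" for R
      using that P(1) rect E unfolding rect_partition_def by (metis Union_upper)
    then show ?thesis
      using sum_bounded_above[of P card m] by simp
  qed
  finally show ?thesis
    by (simp add: P(2) mult.commute)
qed

lemma rect_partition_Un:
  assumes "rect_partition E P" "rect_partition F Q" "E \<inter> F = {}"
  shows "rect_partition (E \<union> F) (P \<union> Q)"
proof -
  have "disjoint (P \<union> Q)"
    using assms by (intro disjoint_union) (auto simp: rect_partition_def partition_on_def)
  then show ?thesis
    using assms(1,2) by (auto simp: rect_partition_def partition_on_def)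
qed

lemma rect_partition_restrict:
  assumes P: "rect_partition (E \<union> F) P"
    and E: "E \<subseteq> A \<times> B" and F: "F \<subseteq> C \<times> D" and disj: "A \<inter> C = {}" "B \<inter> D = {}"
  shows "rect_partition E {R \<in> P. R \<subseteq> E}"
proof -
  have part: "partition_on (E \<union> F) P" and rect: "\<forall>R\<in>P. \<exists>I J. R = I \<times> J"
    using P by (auto simp: rect_partition_def)
  have whole: "R \<subseteq> E" if R: "R \<in> P" and "(v, w) \<in> R" "(v, w) \<in> E" for R v w
  proof clarify
    fix v' w' assume "(v', w') \<in> R"
    then have "(v', w) \<in> E \<union> F" "(v', w') \<in> E \<union> F"
      using rect_partition_closed[OF P R _ \<open>(v, w) \<in> R\<close>] R partition_onD1[OF part] by blast+
    then show "(v', w') \<in> E"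
      using \<open>(v, w) \<in> E\<close> E F disj by blast
  qed
  have "\<Union>{R \<in> P. R \<subseteq> E} = E"
  proof (intro equalityI subsetI)
    fix e assume "e \<in> E"
    moreover obtain R where "R \<in> P" "e \<in> R"
      using \<open>e \<in> E\<close> partition_onD1[OF part] by blast
    moreover from this have "R \<subseteq> E"
      using whole[of R "fst e" "snd e"] \<open>e \<in> E\<close> by simp
    ultimately show "e \<in> \<Union>{R \<in> P. R \<subseteq> E}"
      by blast
  qed blast
  then have "partition_on E {R \<in> P. R \<subseteq> E}"
    using part pairwise_subset[of disjnt P "{R \<in> P. R \<subseteq> E}"] by (simp add: partition_on_def)
  then show ?thesis
    using rect by (simp add: rect_partition_def)
qed

lemma rect_rank_Un:
  assumes fin: "finite E" "finite F"
    and sub: "E \<subseteq> A \<times> B" "F \<subseteq> C \<times> D" and disj: "A \<inter> C = {}" "B \<inter> D = {}"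
  shows "rect_rank (E \<union> F) = rect_rank E + rect_rank F"
proof (rule antisym)
  obtain P Q where P: "rect_partition E P" "card P = rect_rank E"
    and Q: "rect_partition F Q" "card Q = rect_rank F"
    using rect_rank_attained by metis
  have "E \<inter> F = {}"
    using sub disj by blast
  then show "rect_rank (E \<union> F) \<le> rect_rank E + rect_rank F"
    using rect_rank_le[OF rect_partition_Un[OF P(1) Q(1)]] card_Un_le[of P Q] P(2) Q(2) by simp
next
  obtain P where P: "rect_partition (E \<union> F) P" "card P = rect_rank (E \<union> F)"
    by (rule rect_rank_attained)
  let ?E = "{R \<in> P. R \<subseteq> E}" and ?F = "{R \<in> P. R \<subseteq> F}"
  have "?E \<inter> ?F = {}"
  proof -
    have "E \<inter> F = {}"
      using sub disj by blast
    moreover have "{} \<notin> P"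
      using P(1) by (auto simp: rect_partition_def dest: partition_onD3)
    moreover have "R \<subseteq> E \<inter> F" if "R \<in> ?E \<inter> ?F" for R
      using that by simp
    ultimately show ?thesis
      by fastforce
  qed
  moreover have "finite P"
    using finite_rect_partition[OF P(1)] fin by simp
  ultimately have "card ?E + card ?F = card (?E \<union> ?F)" and "card (?E \<union> ?F) \<le> card P"
    by (auto intro: card_Un_disjoint[symmetric] card_mono)
  moreover have "rect_rank E \<le> card ?E"
    by (rule rect_rank_le[OF rect_partition_restrict[OF P(1) sub disj]])
  moreover have "rect_rank F \<le> card ?F"
  proof (rule rect_rank_le[OF rect_partition_restrict[OF _ sub(2,1)]])
    show "rect_partition (F \<union> E) P"
      using P(1) by (simp add: Un_commute)
  qed (use disj in auto)
  ultimately show "rect_rank E + rect_rank F \<le> rect_rank (E \<union> F)"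
    using P(2) by linarith
qed

lemma homogeneous_system_nontrivial:
  fixes c :: "'t \<Rightarrow> 'v \<Rightarrow> 'k::field"
  assumes "finite T" "finite V" "card T < card V"
  obtains x where "\<exists>v\<in>V. x v \<noteq> 0" "\<And>t. t \<in> T \<Longrightarrow> (\<Sum>v\<in>V. c t v * x v) = 0"
proof -
  let ?n = "card V" and ?m = "card T"
  obtain g where g: "bij_betw g {..<?n} V"
    using ex_bij_betw_nat_finite[OF \<open>finite V\<close>] by (auto simp: lessThan_atLeast0)
  obtain h where h: "bij_betw h {..<?m} T"
    using ex_bij_betw_nat_finite[OF \<open>finite T\<close>] by (auto simp: lessThan_atLeast0)
  define A where "A = mat\<^sub>r ?n ?n (\<lambda>i. if i = ?m then 0\<^sub>v ?n else vec ?n (\<lambda>j. c (h i) (g j)))"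
  have A: "A \<in> carrier_mat ?n ?n"
    by (simp add: A_def)
  have "det A = 0"
    unfolding A_def using assms(3) by (intro det_row_0) auto
  then obtain u where u: "u \<in> carrier_vec ?n" "u \<noteq> 0\<^sub>v ?n" "A *\<^sub>v u = 0\<^sub>v ?n"
    using det_0_iff_vec_prod_zero_field[OF A] by blast
  define x where "x v = u $ inv_into {..<?n} g v" for v
  have x_g: "x (g j) = u $ j" if "j < ?n" for j
    using that g by (simp add: x_def bij_betw_def inv_into_f_f)
  show thesis
  proof (rule that)
    obtain j where "j < ?n" "u $ j \<noteq> 0"
      using u(1,2) by (metis carrier_vecD eq_vecI index_zero_vec)
    then show "\<exists>v\<in>V. x v \<noteq> 0"
      using x_g bij_betwE[OF g] by force
  next
    fix t assume "t \<in> T"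
    then obtain i where i: "i < ?m" "t = h i"
      using h by (auto simp: bij_betw_def)
    have "(\<Sum>v\<in>V. c t v * x v) = (\<Sum>j<?n. c t (g j) * x (g j))"
      by (rule sum.reindex_bij_betw[OF g, symmetric])
    also have "\<dots> = (A *\<^sub>v u) $ i"
      using i u(1) assms(3) x_g
      by (simp add: A_def scalar_prod_def lessThan_atLeast0)
    also have "\<dots> = 0"
      using u(3) i assms(3) by simp
    finally show "(\<Sum>v\<in>V. c t v * x v) = 0" .
  qed
qed

lemma sum_row_rect_partition:
  fixes x :: "'b \<Rightarrow> 'k::comm_monoid_add"
  assumes P: "rect_partition E P" and "finite P" "finite C"
  shows "(\<Sum>w\<in>E `` {v} \<inter> C. x w) = (\<Sum>R | R \<in> P \<and> v \<in> Domain R. \<Sum>w\<in>Range R \<inter> C. x w)"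
proof -
  let ?Q = "{R \<in> P. v \<in> Domain R}"
  have part: "partition_on E P"
    using P by (simp add: rect_partition_def)
  have row: "(v, w) \<in> R" if "R \<in> ?Q" "w \<in> Range R" for R w
    using that rect_partition_closed[OF P, of R v] by blast
  have "E `` {v} \<inter> C = (\<Union>R\<in>?Q. Range R \<inter> C)"
    using partition_onD1[OF part] row by blast
  also have "sum x \<dots> = (\<Sum>R\<in>?Q. sum x (Range R \<inter> C))"
  proof (rule sum.UNION_disjoint)
    show "\<forall>R\<in>?Q. \<forall>R'\<in>?Q. R \<noteq> R' \<longrightarrow> (Range R \<inter> C) \<inter> (Range R' \<inter> C) = {}"
      using row disjointD[OF partition_onD2[OF part]] by blast
  qed (use assms in auto)
  finally show ?thesis .
qed

lemma independent_columns_card_le_rect_rank: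
  fixes E :: "('a \<times> 'b) set"
  assumes "finite E" "finite C"
    and indep: "\<And>x :: 'b \<Rightarrow> 'k::field.
      (\<And>v. (\<Sum>w\<in>E `` {v} \<inter> C. x w) = 0) \<Longrightarrow> \<forall>w\<in>C. x w = 0"
  shows "card C \<le> rect_rank E"
proof (rule ccontr)
  assume "\<not> card C \<le> rect_rank E"
  moreover obtain P where P: "rect_partition E P" "card P = rect_rank E"
    by (rule rect_rank_attained)
  moreover have "finite P"
    using finite_rect_partition[OF P(1) \<open>finite E\<close>] .
  ultimately obtain x :: "'b \<Rightarrow> 'k" where x: "\<exists>w\<in>C. x w \<noteq> 0"
    and Px: "\<And>R. R \<in> P \<Longrightarrow> (\<Sum>w\<in>C. of_bool (w \<in> Range R) * x w) = 0"
    using homogeneous_system_nontrivial[of P C "\<lambda>R w. of_bool (w \<in> Range R)"] \<open>finite C\<close>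
    by (metis not_le)
  have "(\<Sum>w\<in>Range R \<inter> C. x w) = 0" if "R \<in> P" for R
    using Px[OF that] \<open>finite C\<close> by (simp add: sum_of_bool_mult_eq Int_commute Int_def)
  then have "(\<Sum>w\<in>E `` {v} \<inter> C. x w) = 0" for v
    by (simp add: sum_row_rect_partition[OF P(1) \<open>finite P\<close> \<open>finite C\<close>])
  then show False
    using indep x by blast
qed

section \<open>Disjoint unions of cycles\<close>

definition cycle_rel :: "nat \<Rightarrow> (nat \<times> nat) set" where
  "cycle_rel k = (SIGMA a:{..<k}. {a, Suc a mod k})"

definition cycles_verts :: "nat list \<Rightarrow> (nat \<times> nat) set" where
  "cycles_verts ns = (SIGMA i:{..<length ns}. {..<ns ! i})"

definition cycles_succ :: "nat list \<Rightarrow> nat \<times> nat \<Rightarrow> nat \<times> nat" where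
  "cycles_succ ns v = (fst v, Suc (snd v) mod ns ! fst v)"

definition cycles_rel :: "nat list \<Rightarrow> ((nat \<times> nat) \<times> (nat \<times> nat)) set" where
  "cycles_rel ns = (SIGMA v:cycles_verts ns. {v, cycles_succ ns v})"

definition cycles_corel :: "nat list \<Rightarrow> ((nat \<times> nat) \<times> (nat \<times> nat)) set" where
  "cycles_corel ns = cycles_verts ns \<times> cycles_verts ns - cycles_rel ns"

lemma fst_cycles_succ [simp]: "fst (cycles_succ ns v) = fst v"
  by (simp add: cycles_succ_def)

lemma finite_cycle_rel [simp]: "finite (cycle_rel k)"
  by (simp add: cycle_rel_def)

lemma map_prod_cycle_rel:
  "map_prod x y ` cycle_rel k = (\<Union>i<k. {x i} \<times> {y i, y (Suc i mod k)})"
  by (force simp: cycle_rel_def)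

lemma cycle_rel_subset: "cycle_rel k \<subseteq> {..<k} \<times> {..<k}"
  by (auto simp: cycle_rel_def)

lemma finite_cycles_verts [simp]: "finite (cycles_verts ns)"
  by (simp add: cycles_verts_def)

lemma finite_cycles_rel [simp]: "finite (cycles_rel ns)"
  by (simp add: cycles_rel_def)

lemma finite_cycles_corel [simp]: "finite (cycles_corel ns)"
  by (simp add: cycles_corel_def)

lemma card_cycles_verts: "card (cycles_verts ns) = sum_list ns"
  by (simp add: cycles_verts_def sum_list_sum_nth atLeast0LessThan)

lemma cycles_succ_in: "v \<in> cycles_verts ns \<Longrightarrow> cycles_succ ns v \<in> cycles_verts ns"
  by (auto simp: cycles_verts_def cycles_succ_def)

lemma cycles_rel_subset: "cycles_rel ns \<subseteq> cycles_verts ns \<times> cycles_verts ns"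
  using cycles_succ_in by (auto simp: cycles_rel_def)

lemma Suc_mod_inj: "a < k \<Longrightarrow> b < k \<Longrightarrow> Suc a mod k = Suc b mod k \<longleftrightarrow> a = b" for k :: nat
  by (auto simp: mod_Suc)

lemma Suc_mod_neq: "2 \<le> k \<Longrightarrow> a < k \<Longrightarrow> Suc a mod k \<noteq> a" for k :: nat
  by (auto simp: mod_Suc)

lemma inj_on_cycles_succ: "inj_on (cycles_succ ns) (cycles_verts ns)"
  by (auto simp: inj_on_def cycles_verts_def cycles_succ_def Suc_mod_inj)

lemma bij_betw_cycles_succ: "bij_betw (cycles_succ ns) (cycles_verts ns) (cycles_verts ns)"
  using inj_on_cycles_succ cycles_succ_in
  by (metis bij_betw_imageI endo_inj_surj finite_cycles_verts image_subsetI)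

lemma cycles_succ_neq:
  "\<forall>k\<in>set ns. 2 \<le> k \<Longrightarrow> v \<in> cycles_verts ns \<Longrightarrow> cycles_succ ns v \<noteq> v"
  using Suc_mod_neq by (cases v) (auto simp: cycles_verts_def cycles_succ_def)

lemma cycles_verts_Cons:
  "cycles_verts (k # ns) = Pair 0 ` {..<k} \<union> map_prod Suc id ` cycles_verts ns"
proof (rule Set.set_eqI)
  fix v show "v \<in> cycles_verts (k # ns) \<longleftrightarrow> v \<in> Pair 0 ` {..<k} \<union> map_prod Suc id ` cycles_verts ns"
    by (cases v; cases "fst v") (force simp: cycles_verts_def)+
qed

lemma cycles_rel_Cons:
  "cycles_rel (k # ns) = map_prod (Pair 0) (Pair 0) ` cycle_rel k \<union>
     map_prod (map_prod Suc id) (map_prod Suc id) ` cycles_rel ns"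
proof -
  have "cycles_succ (k # ns) (0, a) = (0, Suc a mod k)" for a
    by (simp add: cycles_succ_def)
  moreover have "cycles_succ (k # ns) (map_prod Suc id v) = map_prod Suc id (cycles_succ ns v)" for v
    by (cases v) (simp add: cycles_succ_def)
  ultimately show ?thesis
    unfolding cycles_rel_def cycles_verts_Cons cycle_rel_def by (fastforce simp: image_iff)
qed

definition cycles_cons :: "(nat \<Rightarrow> 'a) \<Rightarrow> (nat \<times> nat \<Rightarrow> 'a) \<Rightarrow> nat \<times> nat \<Rightarrow> 'a" where
  "cycles_cons x \<sigma> v = (case v of (0, a) \<Rightarrow> x a | (Suc i, a) \<Rightarrow> \<sigma> (i, a))"

lemma cycles_cons_simps [simp]:
  "cycles_cons x \<sigma> (0, a) = x a" "cycles_cons x \<sigma> (Suc i, a) = \<sigma> (i, a)"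
  by (simp_all add: cycles_cons_def)

lemma cycles_cons_comp:
  "cycles_cons x \<sigma> \<circ> Pair 0 = x" "cycles_cons x \<sigma> \<circ> map_prod Suc id = \<sigma>"
  by auto

lemma bij_betw_cycles_cons:
  assumes "bij_betw x {..<k} A" "bij_betw \<sigma> (cycles_verts ns) B" "A \<inter> B = {}"
  shows "bij_betw (cycles_cons x \<sigma>) (cycles_verts (k # ns)) (A \<union> B)"
  unfolding cycles_verts_Cons
proof (rule bij_betw_combine[OF _ _ assms(3)])
  have "bij_betw (Pair 0) {..<k} (Pair (0::nat) ` {..<k})"
    by (simp add: bij_betw_def inj_on_def)
  then show "bij_betw (cycles_cons x \<sigma>) (Pair 0 ` {..<k}) A"
    using assms(1) by (simp add: bij_betw_comp_iff cycles_cons_comp)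
  have "bij_betw (map_prod Suc id) (cycles_verts ns) (map_prod Suc id ` cycles_verts ns)"
    by (auto simp: bij_betw_def inj_on_def)
  then show "bij_betw (cycles_cons x \<sigma>) (map_prod Suc id ` cycles_verts ns) B"
    using assms(2) by (simp add: bij_betw_comp_iff cycles_cons_comp)
qed

lemma map_prod_cycles_cons_cycles_rel:
  "map_prod (cycles_cons x \<sigma>) (cycles_cons y \<tau>) ` cycles_rel (k # ns) =
     map_prod x y ` cycle_rel k \<union> map_prod \<sigma> \<tau> ` cycles_rel ns"
  by (simp add: cycles_rel_Cons image_Un image_comp map_prod_compose[symmetric] cycles_cons_comp)

section \<open>Binary rank of a disjoint union of cycles\<close>

lemma card_cycle_rel:
  assumes "2 \<le> k"
  shows "card (cycle_rel k) = 2 * k"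
proof -
  have "card {a, Suc a mod k} = 2" if "a < k" for a
    using Suc_mod_neq[OF assms that] by auto
  then show ?thesis
    by (simp add: cycle_rel_def)
qed

lemma cycle_rel_no_four_cycle:
  assumes "2 < k" and "{a, b} \<times> {c, d} \<subseteq> cycle_rel k"
  shows "a = b \<or> c = d"
  using assms by (auto simp: cycle_rel_def mod_Suc split: if_splits)

lemma rect_in_cycle_rel_card_le:
  assumes "2 < k" and rect: "I \<times> J \<subseteq> cycle_rel k"
  shows "card (I \<times> J) \<le> 2"
proof (cases "I \<times> J = {}")
  case False
  then obtain a c where ac: "a \<in> I" "c \<in> J"
    by blast
  have "I = {a} \<or> J = {c}"
  proof (rule ccontr)
    assume "\<not> (I = {a} \<or> J = {c})"
    then obtain b d where "b \<in> I" "b \<noteq> a" "d \<in> J" "d \<noteq> c"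
      using ac by blast
    then show False
      using cycle_rel_no_four_cycle[OF assms(1), of a b c d] rect ac by auto
  qed
  then have "\<exists>u v. I \<times> J \<subseteq> {u, v}"
  proof
    assume I: "I = {a}"
    then have "I \<times> J \<subseteq> {(a, a), (a, Suc a mod k)}"
      using rect by (auto simp: cycle_rel_def)
    then show ?thesis
      by blast
  next
    assume J: "J = {c}"
    have "I \<times> J \<subseteq> {(c, c), (if c = 0 then k - 1 else c - 1, c)}"
      using rect J by (auto simp: cycle_rel_def mod_Suc split: if_splits)
    then show ?thesis
      by blast
  qed
  then obtain u v where "I \<times> J \<subseteq> {u, v}"
    by blast
  then have "card (I \<times> J) \<le> card {u, v}"
    by (intro card_mono) simp_all
  also have "\<dots> \<le> 2"
    by (rule card_insert_le_m1) simp_all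
  finally show ?thesis .
qed (metis card.empty le0)

lemma rect_rank_cycle_rel_two: "rect_rank (cycle_rel 2) = 1"
proof (rule antisym)
  have eq: "cycle_rel 2 = {0, 1} \<times> {0, 1}"
    by (auto simp: cycle_rel_def less_2_cases_iff)
  have "(\<lambda>v. cycle_rel 2 `` {v}) ` Domain (cycle_rel 2) \<subseteq> {{0, 1}}"
    unfolding eq by auto
  from card_mono[OF _ this] show "rect_rank (cycle_rel 2) \<le> 1"
    using rect_rank_le_card_rows[of "cycle_rel 2"] by simp
  have "card (I \<times> J) \<le> 4" if "I \<times> J \<subseteq> cycle_rel 2" for I J
    using card_mono[OF _ that] card_cycle_rel[of 2] by simp
  then show "1 \<le> rect_rank (cycle_rel 2)"
    using card_le_mult_rect_rank[of "cycle_rel 2" 4] card_cycle_rel[of 2] by simp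
qed

lemma rect_rank_cycle_rel:
  assumes "2 < k"
  shows "rect_rank (cycle_rel k) = k"
proof (rule antisym)
  have "card ((\<lambda>v. cycle_rel k `` {v}) ` Domain (cycle_rel k)) \<le> card (Domain (cycle_rel k))"
    by (intro card_image_le finite_Domain) simp
  also have "\<dots> \<le> card {..<k}"
    by (intro card_mono) (auto simp: cycle_rel_def)
  finally show "rect_rank (cycle_rel k) \<le> k"
    using rect_rank_le_card_rows[of "cycle_rel k"] by simp
  show "k \<le> rect_rank (cycle_rel k)"
    using card_le_mult_rect_rank[of "cycle_rel k" 2] rect_in_cycle_rel_card_le[OF assms] assms
    by (simp add: card_cycle_rel)
qed

lemma rect_rank_cycles_rel_Cons:
  "rect_rank (cycles_rel (k # ns)) = rect_rank (cycle_rel k) + rect_rank (cycles_rel ns)"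
proof -
  let ?Z = "Pair 0 :: nat \<Rightarrow> nat \<times> nat" and ?S = "map_prod Suc id :: nat \<times> nat \<Rightarrow> nat \<times> nat"
  have "rect_rank (cycles_rel (k # ns)) =
      rect_rank (map_prod ?Z ?Z ` cycle_rel k) + rect_rank (map_prod ?S ?S ` cycles_rel ns)"
    unfolding cycles_rel_Cons
    by (rule rect_rank_Un[of _ _ "range ?Z" "range ?Z" "range ?S" "range ?S"]) auto
  also have "rect_rank (map_prod ?Z ?Z ` cycle_rel k) = rect_rank (cycle_rel k)"
    by (rule rect_rank_map_prod[of _ UNIV _ UNIV]) (auto simp: inj_on_def)
  also have "rect_rank (map_prod ?S ?S ` cycles_rel ns) = rect_rank (cycles_rel ns)"
    by (rule rect_rank_map_prod[of _ UNIV _ UNIV]) (auto simp: inj_on_def)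
  finally show ?thesis .
qed

lemma rect_rank_cycles_rel:
  assumes "\<forall>k\<in>set ns. 2 \<le> k"
  shows "rect_rank (cycles_rel ns) + length (filter (\<lambda>k. k = 2) ns) = sum_list ns"
  using assms
proof (induction ns)
  case Nil
  then show ?case
    using rect_rank_le_card_rows[of "cycles_rel []"] by (simp add: cycles_rel_def cycles_verts_def)
next
  case (Cons k ns)
  then have "k = 2 \<or> 2 < k"
    by auto
  then show ?case
    using Cons by (auto simp: rect_rank_cycles_rel_Cons rect_rank_cycle_rel rect_rank_cycle_rel_two)
qed

section \<open>Binary rank of the complement of a disjoint union of cycles\<close>

lemma cycles_corel_Image:
  assumes "v \<in> cycles_verts ns"
  shows "cycles_corel ns `` {v} = cycles_verts ns - {v, cycles_succ ns v}"
  using assms by (auto simp: cycles_corel_def cycles_rel_def)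

definition cycles_cell :: "nat list \<Rightarrow> nat \<times> nat \<Rightarrow> (nat \<times> nat) set" where
  "cycles_cell ns v = (if even (ns ! fst v) then {v, cycles_succ ns v} else {v})"

definition parity_tiling :: "nat list \<Rightarrow> (nat \<Rightarrow> bool) \<Rightarrow> (nat \<times> nat) set set" where
  "parity_tiling ns h = cycles_cell ns `
     {v \<in> cycles_verts ns. even (ns ! fst v) \<longrightarrow> (even (snd v) \<longleftrightarrow> h (fst v))}"

definition even_cycle_ends :: "nat list \<Rightarrow> (nat \<times> nat) set" where
  "even_cycle_ends ns = {v \<in> cycles_verts ns. even (ns ! fst v) \<and> Suc (snd v) = ns ! fst v}"

definition corel_columns :: "nat list \<Rightarrow> (nat \<times> nat) set set" where
  "corel_columns ns = insert (\<Union>(cycles_cell ns ` even_cycle_ends ns))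
     (cycles_cell ns ` (cycles_verts ns - even_cycle_ends ns))"

lemma even_snd_cycles_succ:
  assumes "v \<in> cycles_verts ns" "even (ns ! fst v)"
  shows "even (snd (cycles_succ ns v)) \<longleftrightarrow> odd (snd v)"
proof (cases "Suc (snd v) = ns ! fst v")
  case True
  then have "snd (cycles_succ ns v) = 0"
    by (simp add: cycles_succ_def)
  moreover have "odd (snd v)"
    using True assms(2) by (metis even_Suc)
  ultimately show ?thesis
    by simp
next
  case False
  then show ?thesis
    using assms(1) by (auto simp: cycles_verts_def cycles_succ_def mod_Suc)
qed

lemma parity_tiling_mem_iff:
  "C \<in> parity_tiling ns h \<longleftrightarrow> (\<exists>v\<in>cycles_verts ns. C = cycles_cell ns v \<and>
     (even (ns ! fst v) \<longrightarrow> (even (snd v) \<longleftrightarrow> h (fst v))))"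
  by (auto simp: parity_tiling_def)

lemma cycles_cell_mem_iff:
  "u \<in> cycles_cell ns v \<longleftrightarrow> u = v \<or> even (ns ! fst v) \<and> u = cycles_succ ns v"
  by (simp add: cycles_cell_def)

lemma disjoint_parity_tiling: "disjoint (parity_tiling ns h)"
proof (rule disjointI)
  fix C D assume "C \<in> parity_tiling ns h" "D \<in> parity_tiling ns h" "C \<noteq> D"
  then obtain v w where verts: "v \<in> cycles_verts ns" "w \<in> cycles_verts ns"
    and parity: "even (ns ! fst v) \<longrightarrow> (even (snd v) \<longleftrightarrow> h (fst v))"
      "even (ns ! fst w) \<longrightarrow> (even (snd w) \<longleftrightarrow> h (fst w))"
    and CD: "C = cycles_cell ns v" "D = cycles_cell ns w" "v \<noteq> w"
    unfolding parity_tiling_mem_iff by blast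
  show "C \<inter> D = {}"
  proof (rule ccontr)
    assume "C \<inter> D \<noteq> {}"
    then obtain u where "u \<in> cycles_cell ns v" "u \<in> cycles_cell ns w"
      unfolding CD(1,2) by blast
    then have "u = v \<or> even (ns ! fst v) \<and> u = cycles_succ ns v"
      "u = w \<or> even (ns ! fst w) \<and> u = cycles_succ ns w"
      by (simp_all only: cycles_cell_mem_iff)
    then consider (w_after_v) "even (ns ! fst v)" "w = cycles_succ ns v"
      | (v_after_w) "even (ns ! fst w)" "v = cycles_succ ns w"
      | (same_succ) "cycles_succ ns v = cycles_succ ns w"
      using CD(3) by metis
    then show False
    proof cases
      case w_after_v
      then show ?thesis
        using verts(1) parity even_snd_cycles_succ[of v ns] by simp
    next
      case v_after_w
      then show ?thesis
        using verts(2) parity even_snd_cycles_succ[of w ns] by simp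
    next
      case same_succ
      then show ?thesis
        using inj_onD[OF inj_on_cycles_succ] verts CD(3) by blast
    qed
  qed
qed

lemma Union_parity_tiling: "\<Union>(parity_tiling ns h) = cycles_verts ns"
proof (intro equalityI subsetI)
  fix w assume "w \<in> \<Union>(parity_tiling ns h)"
  then show "w \<in> cycles_verts ns"
    using cycles_succ_in by (auto simp: parity_tiling_def cycles_cell_def split: if_splits)
next
  fix w assume w: "w \<in> cycles_verts ns"
  then obtain v where v: "v \<in> cycles_verts ns" "w = cycles_succ ns v"
    using bij_betw_imp_surj_on[OF bij_betw_cycles_succ, of ns] by blast
  show "w \<in> \<Union>(parity_tiling ns h)"
  proof (cases "even (ns ! fst w) \<longrightarrow> (even (snd w) \<longleftrightarrow> h (fst w))")
    case True
    then have "cycles_cell ns w \<in> parity_tiling ns h"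
      using w by (auto simp: parity_tiling_mem_iff)
    then show ?thesis
      by (auto simp: cycles_cell_def split: if_splits)
  next
    case False
    then have even: "even (ns ! fst v)" and "even (snd v) \<longleftrightarrow> h (fst v)"
      using v even_snd_cycles_succ[OF v(1)] by auto
    then have "cycles_cell ns v \<in> parity_tiling ns h"
      using v by (auto simp: parity_tiling_mem_iff)
    then show ?thesis
      using v(2) even by (auto simp: cycles_cell_def)
  qed
qed

lemma tiles_parity_tiling: "tiles (parity_tiling ns h) (cycles_verts ns)"
  by (simp add: tiles_def disjoint_parity_tiling Union_parity_tiling)

lemma even_cycle_ends_odd: "v \<in> even_cycle_ends ns \<Longrightarrow> even (ns ! fst v) \<and> odd (snd v)"
  unfolding even_cycle_ends_def by (metis (mono_tags, lifting) even_Suc mem_Collect_eq)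

lemma tiles_parity_tiling_Diff_cell:
  assumes "v \<in> cycles_verts ns" "even (ns ! fst v)" "even (snd v) \<longleftrightarrow> h (fst v)"
  shows "tiles (parity_tiling ns h - {cycles_cell ns v}) (cycles_verts ns - {v, cycles_succ ns v})"
proof -
  have "{cycles_cell ns v} \<subseteq> parity_tiling ns h"
    using assms by (auto simp: parity_tiling_mem_iff)
  from tiles_Diff[OF tiles_parity_tiling this] show ?thesis
    using assms(2) by (simp add: cycles_cell_def)
qed

lemma parity_tiling_Diff_ends_subset:
  assumes "\<And>v. v \<in> even_cycle_ends ns \<Longrightarrow> \<not> h (fst v) \<Longrightarrow> cycles_cell ns v \<in> \<R>"
  shows "parity_tiling ns h - \<R> \<subseteq> corel_columns ns"
proof
  fix C assume "C \<in> parity_tiling ns h - \<R>"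
  then obtain v where v: "v \<in> cycles_verts ns" "C = cycles_cell ns v" "C \<notin> \<R>"
      "even (ns ! fst v) \<longrightarrow> (even (snd v) \<longleftrightarrow> h (fst v))"
    by (auto simp: parity_tiling_mem_iff)
  then have "v \<notin> even_cycle_ends ns"
    using assms even_cycle_ends_odd by blast
  then show "C \<in> corel_columns ns"
    using v by (simp add: corel_columns_def)
qed

lemma corel_columns_tile_odd_cycle_row:
  assumes v: "v \<in> cycles_verts ns" and odd: "odd (ns ! fst v)"
  shows "\<exists>\<D>\<subseteq>corel_columns ns. tiles \<D> (cycles_verts ns - {v, cycles_succ ns v})"
proof (intro exI conjI)
  let ?B = "parity_tiling ns (\<lambda>_. True)" and ?R = "{{v}, {cycles_succ ns v}}"
  have "cycles_cell ns v \<in> ?B" "cycles_cell ns (cycles_succ ns v) \<in> ?B"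
    unfolding parity_tiling_mem_iff using v cycles_succ_in[OF v] odd by (auto intro!: bexI)
  then have "?R \<subseteq> ?B"
    using odd by (simp add: cycles_cell_def)
  from tiles_Diff[OF tiles_parity_tiling this]
  show "tiles (?B - ?R) (cycles_verts ns - {v, cycles_succ ns v})"
    by (simp add: insert_commute)
  show "?B - ?R \<subseteq> corel_columns ns"
    by (rule parity_tiling_Diff_ends_subset) simp
qed

text \<open>The tiling by the cells of odd positions contains all cells of \<^const>\<open>even_cycle_ends\<close>;
  these are merged into the first member of \<^const>\<open>corel_columns\<close>.\<close>

lemma corel_columns_tile_odd_position_row:
  assumes v: "v \<in> cycles_verts ns" "v \<notin> even_cycle_ends ns" and even: "even (ns ! fst v)"
    and odd: "odd (snd v)"
  shows "\<exists>\<D>\<subseteq>corel_columns ns. tiles \<D> (cycles_verts ns - {v, cycles_succ ns v})"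
proof -
  let ?B = "parity_tiling ns (\<lambda>_. False)" and ?L = "cycles_cell ns ` even_cycle_ends ns"
  let ?D = "insert (\<Union>?L) (?B - {cycles_cell ns v} - ?L)"
  have "cycles_cell ns w \<in> ?B" if "w \<in> even_cycle_ends ns" for w
    using that even_cycle_ends_odd[OF that] by (auto simp: parity_tiling_mem_iff even_cycle_ends_def)
  moreover have "cycles_cell ns w \<noteq> cycles_cell ns v" if w: "w \<in> even_cycle_ends ns" for w
  proof
    assume "cycles_cell ns w = cycles_cell ns v"
    then have "v = w \<or> v = cycles_succ ns w"
      by (auto simp: cycles_cell_def split: if_splits)
    moreover have "snd (cycles_succ ns w) = 0"
      using w by (simp add: cycles_succ_def even_cycle_ends_def)
    ultimately show False
      using v(2) w odd by auto
  qed
  ultimately have "?L \<subseteq> ?B - {cycles_cell ns v}"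
    by blast
  then have "tiles ?D (cycles_verts ns - {v, cycles_succ ns v})"
    using tiles_merge[OF tiles_parity_tiling_Diff_cell[OF v(1) even]] odd by simp
  moreover have "?B - ?L \<subseteq> corel_columns ns"
    by (rule parity_tiling_Diff_ends_subset) simp
  then have "?D \<subseteq> corel_columns ns"
    by (auto simp: corel_columns_def)
  ultimately show ?thesis
    by blast
qed

lemma corel_columns_tile_row:
  assumes v: "v \<in> cycles_verts ns"
  shows "\<exists>\<D>\<subseteq>corel_columns ns. tiles \<D> (cycles_verts ns - {v, cycles_succ ns v})"
proof -
  consider (odd_cycle) "odd (ns ! fst v)" | (even_position) "even (ns ! fst v)" "even (snd v)"
    | (cycle_end) "v \<in> even_cycle_ends ns"
    | (odd_position) "v \<notin> even_cycle_ends ns" "even (ns ! fst v)" "odd (snd v)"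
    by blast
  then show ?thesis
  proof cases
    case even_position
    let ?D = "parity_tiling ns (\<lambda>_. True) - {cycles_cell ns v}"
    have "?D \<subseteq> corel_columns ns"
      by (rule parity_tiling_Diff_ends_subset) simp
    then show ?thesis
      using tiles_parity_tiling_Diff_cell[OF v, of "\<lambda>_. True"] even_position by auto
  next
    case cycle_end
    let ?h = "\<lambda>i. i \<noteq> fst v"
    let ?D = "parity_tiling ns ?h - {cycles_cell ns v}"
    have "w = v" if "w \<in> even_cycle_ends ns" "fst w = fst v" for w
      using that cycle_end by (auto simp: even_cycle_ends_def prod_eq_iff)
    then have "?D \<subseteq> corel_columns ns"
      by (intro parity_tiling_Diff_ends_subset) auto
    then show ?thesis
      using tiles_parity_tiling_Diff_cell[OF v, of ?h] even_cycle_ends_odd[OF cycle_end] by auto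
  qed (use v corel_columns_tile_odd_cycle_row corel_columns_tile_odd_position_row in blast)+
qed

lemma card_even_cycle_ends:
  assumes "0 \<notin> set ns"
  shows "card (even_cycle_ends ns) = length (filter even ns)"
proof -
  have "even_cycle_ends ns = (\<lambda>i. (i, ns ! i - 1)) ` {i. i < length ns \<and> even (ns ! i)}"
  proof -
    have "0 < ns ! i" if "i < length ns" for i
      using that assms by (metis gr0I nth_mem)
    then show ?thesis
      by (force simp: even_cycle_ends_def cycles_verts_def)
  qed
  then show ?thesis
    by (simp add: card_image inj_on_def length_filter_conv_card)
qed

lemma rect_rank_cycles_corel_le:
  assumes "0 \<notin> set ns"
  shows "rect_rank (cycles_corel ns) + length (filter even ns) \<le> sum_list ns + 1"
proof -
  have ends: "even_cycle_ends ns \<subseteq> cycles_verts ns"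
    by (auto simp: even_cycle_ends_def)
  have "rect_rank (cycles_corel ns) \<le> card (corel_columns ns)"
  proof (rule rect_rank_le_row_tiles)
    fix v assume "v \<in> Domain (cycles_corel ns)"
    then have "v \<in> cycles_verts ns"
      by (auto simp: cycles_corel_def)
    then show "\<exists>\<D>\<subseteq>corel_columns ns. tiles \<D> (cycles_corel ns `` {v})"
      using corel_columns_tile_row by (simp add: cycles_corel_Image)
  qed (simp add: corel_columns_def)
  also have "\<dots> \<le> Suc (card (cycles_cell ns ` (cycles_verts ns - even_cycle_ends ns)))"
    unfolding corel_columns_def by (rule card_insert_le_m1) simp_all
  also have "\<dots> \<le> Suc (card (cycles_verts ns - even_cycle_ends ns))"
    by (simp add: card_image_le)
  also have "card (cycles_verts ns - even_cycle_ends ns) = sum_list ns - length (filter even ns)"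
    using ends card_Diff_subset[OF finite_subset[OF ends] ends] assms
    by (simp add: card_cycles_verts card_even_cycle_ends)
  finally show ?thesis
    using card_mono[OF _ ends] assms by (simp add: card_cycles_verts card_even_cycle_ends)
qed

lemma alternating_on_cycles_eq_zero:
  fixes x :: "nat \<times> nat \<Rightarrow> real"
  assumes alt: "\<And>v. v \<in> cycles_verts ns \<Longrightarrow> x (cycles_succ ns v) = - x v"
    and zero: "\<And>i. i < length ns \<Longrightarrow> even (ns ! i) \<Longrightarrow> x (i, 0) = 0"
    and v: "v \<in> cycles_verts ns"
  shows "x v = 0"
proof -
  obtain i b where i: "v = (i, b)" "i < length ns" "b < ns ! i"
    using v by (auto simp: cycles_verts_def)
  have sign: "x (i, a) = (- 1) ^ a * x (i, 0)" if "a < ns ! i" for a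
    using that
  proof (induction a)
    case (Suc a)
    then show ?case
      using alt[of "(i, a)"] i(2) by (simp add: cycles_verts_def cycles_succ_def)
  qed simp
  have "x (i, 0) = 0"
  proof (cases "even (ns ! i)")
    case False
    then obtain m where m: "ns ! i = Suc m" "even m"
      by (cases "ns ! i") auto
    then have "x (i, 0) = - x (i, m)"
      using alt[of "(i, m)"] i(2) by (simp add: cycles_verts_def cycles_succ_def)
    moreover have "x (i, m) = x (i, 0)"
      using sign[of m] m by simp
    ultimately show ?thesis
      by simp
  qed (use zero i(2) in blast)
  then show ?thesis
    using sign[OF i(3)] i(1) by simp
qed

lemma corel_kernel_alternating:
  fixes x :: "nat \<times> nat \<Rightarrow> real"
  assumes "\<forall>k\<in>set ns. 2 \<le> k" and "sum_list ns \<noteq> 2"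
    and row: "\<And>v. v \<in> cycles_verts ns \<Longrightarrow> (\<Sum>w\<in>cycles_corel ns `` {v}. x w) = 0"
    and v: "v \<in> cycles_verts ns"
  shows "x (cycles_succ ns v) = - x v"
proof -
  define S where "S = (\<Sum>w\<in>cycles_verts ns. x w)"
  have pair: "x v + x (cycles_succ ns v) = S" if v: "v \<in> cycles_verts ns" for v
  proof -
    have "S - (\<Sum>w\<in>{v, cycles_succ ns v}. x w) = (\<Sum>w\<in>cycles_corel ns `` {v}. x w)"
      unfolding S_def cycles_corel_Image[OF v] using v cycles_succ_in[OF v]
      by (intro sum_diff[symmetric]) auto
    then show ?thesis
      using row[OF v] cycles_succ_neq[OF assms(1) v] by simp
  qed
  have "(\<Sum>v\<in>cycles_verts ns. x (cycles_succ ns v)) = S"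
    unfolding S_def using bij_betw_cycles_succ by (rule sum.reindex_bij_betw)
  then have "2 * S = (\<Sum>v\<in>cycles_verts ns. x v + x (cycles_succ ns v))"
    by (simp add: sum.distrib S_def)
  also have "\<dots> = sum_list ns * S"
    using pair by (simp add: card_cycles_verts)
  finally have "S = 0"
    using assms(2) by simp
  then show ?thesis
    using pair[OF v] by simp
qed

lemma rect_rank_cycles_corel_ge:
  assumes "\<forall>k\<in>set ns. 2 \<le> k" and "sum_list ns \<noteq> 2"
  shows "sum_list ns \<le> rect_rank (cycles_corel ns) + length (filter even ns)"
proof -
  let ?Z = "(\<lambda>i. (i, 0 :: nat)) ` {i. i < length ns \<and> even (ns ! i)}"
  let ?C = "cycles_verts ns - ?Z"
  have "card ?C \<le> rect_rank (cycles_corel ns)"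
  proof (rule independent_columns_card_le_rect_rank)
    fix x :: "nat \<times> nat \<Rightarrow> real"
    assume kernel: "\<And>v. (\<Sum>w\<in>cycles_corel ns `` {v} \<inter> ?C. x w) = 0"
    define y where "y w = (if w \<in> ?C then x w else 0)" for w
    have "(\<Sum>w\<in>cycles_corel ns `` {v}. y w) = 0" for v
      using kernel[of v] unfolding y_def by (subst sum.inter_restrict[symmetric]) auto
    then have alt: "y (cycles_succ ns v) = - y v" if "v \<in> cycles_verts ns" for v
      using corel_kernel_alternating[OF assms] that by blast
    have "y v = 0" if "v \<in> cycles_verts ns" for v
      using alternating_on_cycles_eq_zero[of ns y, OF alt _ that] by (auto simp: y_def)
    then show "\<forall>w\<in>?C. x w = 0"
      by (metis DiffD1 y_def)
  qed simp_all
  moreover have "card ?Z = length (filter even ns)"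
    by (simp add: card_image inj_on_def length_filter_conv_card)
  moreover have "card (cycles_verts ns) - card ?Z \<le> card ?C"
    by (rule diff_card_le_card_Diff) simp
  ultimately show ?thesis
    by (simp add: card_cycles_verts)
qed

section \<open>Cycle decomposition of 2-regular relations\<close>

definition free_involution :: "('a \<Rightarrow> 'a) \<Rightarrow> 'a set \<Rightarrow> bool" where
  "free_involution a D \<longleftrightarrow> a \<circ> a = id \<and> {e. a e \<noteq> e} = D"

lemma free_involution_involutive: "free_involution a D \<Longrightarrow> a (a e) = e"
  unfolding free_involution_def by (metis comp_apply id_apply)

lemma free_involution_neq: "free_involution a D \<Longrightarrow> e \<in> D \<Longrightarrow> a e \<noteq> e"
  by (auto simp: free_involution_def)

lemma free_involution_in: "free_involution a D \<Longrightarrow> e \<in> D \<Longrightarrow> a e \<in> D"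
  using free_involution_involutive[of a D e] by (auto simp: free_involution_def)

lemma free_involution_permutation:
  assumes "free_involution a D" "finite D"
  shows "permutation a"
proof -
  have "bij a"
    using assms(1) by (intro o_bij[of a]) (auto simp: free_involution_def)
  moreover have "finite {e. a e \<noteq> e}"
    using assms by (simp add: free_involution_def)
  ultimately show ?thesis
    by (simp add: permutation)
qed

text \<open>The map \<open>a \<circ> (b \<circ> a) ^^ n\<close> is conjugate to \<open>a\<close> or \<open>b\<close> and hence has no fixed point in \<open>D\<close>.\<close>

lemma funpow_free_involutions_neq:
  assumes a: "free_involution a D" and b: "free_involution b D" and "e \<in> D"
  shows "((b \<circ> a) ^^ n) e \<noteq> a e"
  using \<open>e \<in> D\<close>
proof (induction n arbitrary: e rule: induct_nat_012)
  case 0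
  then show ?case
    using free_involution_neq[OF a] by (metis eq_id_iff funpow_0)
next
  case 1
  then show ?case
    using free_involution_neq[OF b] free_involution_in[OF a] by simp
next
  case (ge2 n)
  let ?f = "b \<circ> a"
  show ?case
  proof
    assume "(?f ^^ Suc (Suc n)) e = a e"
    then have "b (a ((?f ^^ n) (?f e))) = a e"
      by (metis comp_apply funpow.simps(2) funpow_swap1)
    then have "(?f ^^ n) (?f e) = a (?f e)"
      using free_involution_involutive[OF a] free_involution_involutive[OF b] by (metis comp_apply)
    moreover have "?f e \<in> D"
      using free_involution_in[OF a] free_involution_in[OF b] ge2.prems by simp
    ultimately show False
      using ge2.IH by blast
  qed
qed

lemma free_involutions_orbit:
  assumes "finite D" and a: "free_involution a D" and b: "free_involution b D" and "D \<noteq> {}"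
  obtains k and e :: "nat \<Rightarrow> 'a" where "0 < k" "inj_on e {..<k}" "\<And>i. e (i mod k) = e i"
    "\<And>i. e i \<in> D" "\<And>i. e (Suc i) = b (a (e i))" "\<And>i j. e i \<noteq> a (e j)"
proof -
  obtain d where "d \<in> D"
    using \<open>D \<noteq> {}\<close> by blast
  let ?f = "b \<circ> a" and ?k = "least_power (b \<circ> a) d"
  define e where "e i = (?f ^^ i) d" for i
  have perm: "permutation ?f"
    using free_involution_permutation[OF b \<open>finite D\<close>] free_involution_permutation[OF a \<open>finite D\<close>]
    by (rule permutation_compose)
  have in_D: "e i \<in> D" for i
    using \<open>d \<in> D\<close> free_involution_in[OF a] free_involution_in[OF b]
    by (induction i) (simp_all add: e_def)
  have neq_if_le: "e i \<noteq> a (e j)" if "j \<le> i" for i j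
    using funpow_free_involutions_neq[OF a b in_D, of "i - j" j] that
    by (simp add: e_def flip: funpow_add[THEN fun_cong, unfolded comp_apply])
  show thesis
  proof (rule that)
    show "0 < ?k" and "e (i mod ?k) = e i" for i
      using least_power_of_permutation[OF perm, of d] by (simp_all add: e_def funpow_mod_eq)
    have "distinct (map e [0..<?k])"
      using cycle_of_permutation[OF perm, of d] by (simp add: e_def[abs_def])
    then show "inj_on e {..<?k}"
      by (simp add: distinct_map lessThan_atLeast0)
    show "e i \<noteq> a (e j)" for i j
      using neq_if_le[of i j] neq_if_le[of j i] free_involution_involutive[OF a] by (metis nat_le_linear)
  qed (simp_all add: in_D, simp add: e_def)
qed

definition regular_rel :: "nat \<Rightarrow> 'a set \<Rightarrow> 'b set \<Rightarrow> ('a \<times> 'b) set \<Rightarrow> bool" where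
  "regular_rel k X Y E \<longleftrightarrow> E \<subseteq> X \<times> Y \<and>
     (\<forall>x\<in>X. card (E `` {x}) = k) \<and> (\<forall>y\<in>Y. card (E\<inverse> `` {y}) = k)"

lemma regular_rel_converse: "regular_rel k X Y E \<Longrightarrow> regular_rel k Y X (E\<inverse>)"
  by (auto simp: regular_rel_def)

lemma regular_rel_Diff:
  assumes E: "regular_rel k X Y E" and AB: "E \<inter> A \<times> UNIV = E \<inter> UNIV \<times> B"
  shows "regular_rel k (X - A) (Y - B) (E - A \<times> B)"
proof -
  have "(E - A \<times> B) `` {x} = E `` {x}" if "x \<in> X - A" for x
    using that by auto
  moreover have "(E - A \<times> B)\<inverse> `` {y} = E\<inverse> `` {y}" if "y \<in> Y - B" for y
    using that by auto
  moreover have "E - A \<times> B \<subseteq> (X - A) \<times> (Y - B)"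
    using E AB by (auto simp: regular_rel_def)
  ultimately show ?thesis
    using E by (simp add: regular_rel_def)
qed

definition other :: "'a set \<Rightarrow> 'a \<Rightarrow> 'a" where
  "other S a = the_elem (S - {a})"

lemma doubleton_other:
  assumes "card S = 2" "a \<in> S"
  shows "S = {a, other S a}" "other S a \<noteq> a"
proof -
  obtain b where "S = {a, b}" "b \<noteq> a"
    using assms by (metis card_2_iff doubleton_eq_iff insertE singletonD)
  moreover from this have "other S a = b"
    by (simp add: other_def insert_Diff_if)
  ultimately show "S = {a, other S a}" "other S a \<noteq> a"
    by simp_all
qed

definition row_flip :: "('a \<times> 'b) set \<Rightarrow> 'a \<times> 'b \<Rightarrow> 'a \<times> 'b" where
  "row_flip E e = (if e \<in> E then (fst e, other (E `` {fst e}) (snd e)) else e)"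

definition col_flip :: "('a \<times> 'b) set \<Rightarrow> 'a \<times> 'b \<Rightarrow> 'a \<times> 'b" where
  "col_flip E = prod.swap \<circ> row_flip (E\<inverse>) \<circ> prod.swap"

lemma fst_row_flip [simp]: "fst (row_flip E e) = fst e"
  by (simp add: row_flip_def)

lemma snd_col_flip [simp]: "snd (col_flip E e) = snd e"
  by (simp add: col_flip_def)

lemma row_flip_two_regular:
  assumes "regular_rel 2 X Y E" "e \<in> E"
  shows "E `` {fst e} = {snd e, snd (row_flip E e)}" "snd (row_flip E e) \<noteq> snd e"
proof -
  have "card (E `` {fst e}) = 2" "snd e \<in> E `` {fst e}"
    using assms by (auto simp: regular_rel_def mem_Times_iff)
  from doubleton_other[OF this] show "E `` {fst e} = {snd e, snd (row_flip E e)}"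
    "snd (row_flip E e) \<noteq> snd e"
    using assms(2) by (simp_all add: row_flip_def)
qed

lemma col_flip_two_regular:
  assumes "regular_rel 2 X Y E" "e \<in> E"
  shows "E\<inverse> `` {snd e} = {fst e, fst (col_flip E e)}"
proof -
  have "prod.swap e \<in> E\<inverse>"
    using assms(2) by (cases e) simp
  from row_flip_two_regular(1)[OF regular_rel_converse[OF assms(1)] this] show ?thesis
    by (simp add: col_flip_def)
qed

lemma free_involution_row_flip:
  assumes E: "regular_rel 2 X Y E"
  shows "free_involution (row_flip E) E"
proof -
  have in_E: "row_flip E e \<in> E" if "e \<in> E" for e
    using row_flip_two_regular(1)[OF E that]
    by (metis Image_singleton_iff fst_row_flip insertCI prod.collapse)
  have "row_flip E (row_flip E e) = e" for e
  proof (cases "e \<in> E")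
    case True
    have "snd e \<in> {snd (row_flip E e), snd (row_flip E (row_flip E e))}"
      using row_flip_two_regular(1)[OF E in_E[OF True]] row_flip_two_regular(1)[OF E True]
      by (metis fst_row_flip insertI1)
    then have "snd (row_flip E (row_flip E e)) = snd e"
      using row_flip_two_regular(2)[OF E True] by auto
    then show ?thesis
      by (simp add: prod_eq_iff)
  qed (simp add: row_flip_def)
  moreover have "row_flip E e \<noteq> e \<longleftrightarrow> e \<in> E" for e
    using row_flip_two_regular(2)[OF E] by (metis row_flip_def)
  ultimately show ?thesis
    by (simp add: free_involution_def fun_eq_iff)
qed

lemma free_involution_col_flip:
  assumes "regular_rel 2 X Y E"
  shows "free_involution (col_flip E) E"
proof -
  have "free_involution (row_flip (E\<inverse>)) (E\<inverse>)"
    using free_involution_row_flip[OF regular_rel_converse[OF assms]] .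
  then have "row_flip (E\<inverse>) (row_flip (E\<inverse>) e) = e" "row_flip (E\<inverse>) e \<noteq> e \<longleftrightarrow> e \<in> E\<inverse>" for e
    by (auto simp: free_involution_involutive) (auto simp: free_involution_def)
  moreover have "prod.swap u = v \<longleftrightarrow> u = prod.swap v" for u :: "'b \<times> 'a" and v
    by auto
  ultimately show ?thesis
    by (simp add: free_involution_def col_flip_def fun_eq_iff) force
qed

lemma eq_or_row_flip:
  assumes "regular_rel 2 X Y E" "e \<in> E" "e' \<in> E" "fst e' = fst e"
  shows "e' = e \<or> e' = row_flip E e"
proof -
  have "snd e' \<in> E `` {fst e}"
    using assms(3,4) by (metis ImageI prod.collapse singletonI)
  then have "snd e' = snd e \<or> snd e' = snd (row_flip E e)"
    using row_flip_two_regular(1)[OF assms(1,2)] by simp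
  then show ?thesis
    using assms(4) by (simp add: prod_eq_iff)
qed

lemma eq_or_col_flip:
  assumes "regular_rel 2 X Y E" "e \<in> E" "e' \<in> E" "snd e' = snd e"
  shows "e' = e \<or> e' = col_flip E e"
proof -
  have "prod.swap e \<in> E\<inverse>" "prod.swap e' \<in> E\<inverse>"
    using assms(2,3) by (cases e; cases e'; simp)+
  from eq_or_row_flip[OF regular_rel_converse[OF assms(1)] this]
  have "prod.swap e' = prod.swap e \<or> prod.swap e' = prod.swap (col_flip E e)"
    using assms(4) by (simp add: col_flip_def)
  then show ?thesis
    by (metis swap_swap)
qed

lemma periodic_predecessor:
  fixes f :: "nat \<Rightarrow> 'a"
  assumes "0 < k" and periodic: "\<And>i. f (i mod k) = f i"
  shows "\<exists>m. f (Suc m) = f i"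
  using assms by (metis Suc_pred add_gr_0 mod_add_self2)

lemma two_regular_rel_edge_orbit:
  assumes "finite E" "E \<noteq> {}" and E: "regular_rel 2 X Y E"
  obtains k and e :: "nat \<Rightarrow> 'a \<times> 'b" where "0 < k" "inj_on e {..<k}" "\<And>i. e (i mod k) = e i"
    "\<And>i. e i \<in> E" "\<And>i. col_flip E (e (Suc i)) = row_flip E (e i)" "\<And>i j. e i \<noteq> row_flip E (e j)"
proof -
  note row = free_involution_row_flip[OF E] and col = free_involution_col_flip[OF E]
  obtain k and e :: "nat \<Rightarrow> 'a \<times> 'b" where e: "0 < k" "inj_on e {..<k}" "\<And>i. e (i mod k) = e i"
      "\<And>i. e i \<in> E" "\<And>i j. e i \<noteq> row_flip E (e j)"
    and e_Suc: "\<And>i. e (Suc i) = col_flip E (row_flip E (e i))"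
    using free_involutions_orbit[OF \<open>finite E\<close> row col \<open>E \<noteq> {}\<close>] by metis
  have "col_flip E (e (Suc i)) = row_flip E (e i)" for i
    unfolding e_Suc by (rule free_involution_involutive[OF col])
  with e show thesis
    using that by blast
qed

lemma two_regular_rel_walk:
  assumes "finite E" "E \<noteq> {}" and E: "regular_rel 2 X Y E"
  obtains k x y where "0 < k" "inj_on x {..<k}" "inj_on y {..<k}"
    "\<And>i. x (i mod k) = x i" "\<And>i. y (i mod k) = y i" "\<And>i. y (Suc i) \<noteq> y i"
    "\<And>i. E `` {x i} = {y i, y (Suc i)}" "\<And>i. E\<inverse> `` {y (Suc i)} = {x (Suc i), x i}"
proof -
  obtain k and e :: "nat \<Rightarrow> 'a \<times> 'b" where k: "0 < k" and inj: "inj_on e {..<k}"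
    and e_mod: "\<And>i. e (i mod k) = e i" and e_in: "\<And>i. e i \<in> E"
    and flip: "\<And>i. col_flip E (e (Suc i)) = row_flip E (e i)"
    and e_neq: "\<And>i j. e i \<noteq> row_flip E (e j)"
    using two_regular_rel_edge_orbit[OF assms] by metis
  have snd_flip: "snd (row_flip E (e i)) = snd (e (Suc i))" for i
    by (metis flip snd_col_flip)
  show thesis
  proof (rule that[of k "fst \<circ> e" "snd \<circ> e"])
    show "inj_on (fst \<circ> e) {..<k}"
    proof (rule inj_onI)
      fix i j assume ij: "i \<in> {..<k}" "j \<in> {..<k}" and "(fst \<circ> e) i = (fst \<circ> e) j"
      then have "e i = e j"
        using eq_or_row_flip[OF E e_in e_in, of i j] e_neq by auto
      then show "i = j"
        using inj_onD[OF inj _ ij] by blast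
    qed
    show "inj_on (snd \<circ> e) {..<k}"
    proof (rule inj_onI)
      fix i j assume ij: "i \<in> {..<k}" "j \<in> {..<k}" and eq: "(snd \<circ> e) i = (snd \<circ> e) j"
      obtain m where m: "e (Suc m) = e j"
        using periodic_predecessor[of k e, OF k e_mod] by blast
      then have "e i = e (Suc m) \<or> e i = row_flip E (e m)"
        unfolding flip[symmetric] using eq by (intro eq_or_col_flip[OF E e_in e_in]) simp
      then show "i = j"
        using e_neq inj_onD[OF inj _ ij] m by metis
    qed
    show "E `` {(fst \<circ> e) i} = {(snd \<circ> e) i, (snd \<circ> e) (Suc i)}"
      "(snd \<circ> e) (Suc i) \<noteq> (snd \<circ> e) i" for i
      using row_flip_two_regular[OF E e_in, of i] by (simp_all add: snd_flip)
    show "E\<inverse> `` {(snd \<circ> e) (Suc i)} = {(fst \<circ> e) (Suc i), (fst \<circ> e) i}" for i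
      using col_flip_two_regular[OF E e_in, of "Suc i"] by (simp add: flip)
  qed (use k e_mod in simp_all)
qed

lemma two_regular_rel_cycle:
  assumes "finite E" "E \<noteq> {}" "regular_rel 2 X Y E"
  obtains k x y where "2 \<le> k" "inj_on x {..<k}" "inj_on y {..<k}"
    "E \<inter> x ` {..<k} \<times> UNIV = map_prod x y ` cycle_rel k"
    "E \<inter> UNIV \<times> y ` {..<k} = map_prod x y ` cycle_rel k"
proof -
  obtain k x y where k: "0 < k" and inj: "inj_on x {..<k}" "inj_on y {..<k}"
    and x_mod: "\<And>i. x (i mod k) = x i" and y_mod: "\<And>i. y (i mod k) = y i"
    and y_neq: "\<And>i. y (Suc i) \<noteq> y i"
    and row: "\<And>i. E `` {x i} = {y i, y (Suc i)}" and col: "\<And>i. E\<inverse> `` {y (Suc i)} = {x (Suc i), x i}"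
    using two_regular_rel_walk[OF assms] by metis
  have "E \<inter> x ` {..<k} \<times> UNIV = (\<Union>i<k. {x i} \<times> E `` {x i})"
    by auto
  also have "\<dots> = map_prod x y ` cycle_rel k"
    by (simp add: row y_mod map_prod_cycle_rel)
  finally have rows: "E \<inter> x ` {..<k} \<times> UNIV = map_prod x y ` cycle_rel k" .
  have "u \<in> x ` {..<k}" if "(u, y i) \<in> E" for u i
  proof -
    obtain m where "y (Suc m) = y i"
      using periodic_predecessor[of k y, OF k y_mod] by blast
    then have "u = x (Suc m) \<or> u = x m"
      using that col[of m] by auto
    then show ?thesis
      using x_mod k by (metis imageI lessThan_iff mod_less_divisor)
  qed
  then have "E \<inter> UNIV \<times> y ` {..<k} \<subseteq> map_prod x y ` cycle_rel k"
    unfolding rows[symmetric] by auto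
  moreover have "map_prod x y ` cycle_rel k \<subseteq> E \<inter> UNIV \<times> y ` {..<k}"
    using rows cycle_rel_subset[of k] by auto
  moreover have "2 \<le> k"
    using k y_neq[of 0] y_mod[of 1] by (cases "k = 1") auto
  ultimately show thesis
    using that inj rows by blast
qed

lemma two_regular_rel_split_cycle:
  assumes "finite E" "E \<noteq> {}" and E: "regular_rel 2 X Y E"
  obtains k x y A B where "2 \<le> k" "bij_betw x {..<k} A" "bij_betw y {..<k} B" "A \<subseteq> X" "B \<subseteq> Y"
    "E \<inter> A \<times> B = map_prod x y ` cycle_rel k" "regular_rel 2 (X - A) (Y - B) (E - A \<times> B)"
proof -
  obtain k x y where k: "2 \<le> k" and inj: "inj_on x {..<k}" "inj_on y {..<k}"
    and rows: "E \<inter> x ` {..<k} \<times> UNIV = map_prod x y ` cycle_rel k"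
    and cols: "E \<inter> UNIV \<times> y ` {..<k} = map_prod x y ` cycle_rel k"
    using two_regular_rel_cycle[OF assms] by metis
  have "(x i, y i) \<in> E" if "i < k" for i
  proof -
    have "(x i, y i) \<in> map_prod x y ` cycle_rel k"
      using that by (force simp: cycle_rel_def)
    then show ?thesis
      unfolding rows[symmetric] by simp
  qed
  then have "x ` {..<k} \<subseteq> X" "y ` {..<k} \<subseteq> Y"
    using E by (auto simp: regular_rel_def)
  moreover have "E \<inter> x ` {..<k} \<times> y ` {..<k} = map_prod x y ` cycle_rel k"
    using rows cols by blast
  moreover have "regular_rel 2 (X - x ` {..<k}) (Y - y ` {..<k}) (E - x ` {..<k} \<times> y ` {..<k})"
    using E rows cols by (intro regular_rel_Diff) simp_all
  ultimately show thesis
    using that[OF k inj_on_imp_bij_betw[OF inj(1)] inj_on_imp_bij_betw[OF inj(2)]] by blast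
qed

lemma two_regular_rel_cycles:
  assumes "finite E" "regular_rel 2 X Y E"
  shows "\<exists>ns \<sigma> \<tau>. (\<forall>k\<in>set ns. 2 \<le> k) \<and> bij_betw \<sigma> (cycles_verts ns) X \<and>
    bij_betw \<tau> (cycles_verts ns) Y \<and> E = map_prod \<sigma> \<tau> ` cycles_rel ns"
  using assms
proof (induction E arbitrary: X Y rule: finite_psubset_induct)
  case (psubset E)
  show ?case
  proof (cases "E = {}")
    case True
    then have "X = {}" "Y = {}"
      using psubset.prems by (auto simp: regular_rel_def)
    then show ?thesis
      using True by (intro exI[of _ "[]"]) (simp add: cycles_verts_def cycles_rel_def bij_betw_def)
  next
    case False
    then obtain k x y A B where k: "2 \<le> k" and x: "bij_betw x {..<k} A" and y: "bij_betw y {..<k} B"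
      and sub: "A \<subseteq> X" "B \<subseteq> Y" and cycle: "E \<inter> A \<times> B = map_prod x y ` cycle_rel k"
      and reg: "regular_rel 2 (X - A) (Y - B) (E - A \<times> B)"
      using two_regular_rel_split_cycle[OF psubset.hyps _ psubset.prems] by metis
    have "(0, 0) \<in> cycle_rel k"
      using k by (simp add: cycle_rel_def)
    then have "E - A \<times> B \<subset> E"
      using cycle by blast
    then obtain ns \<sigma> \<tau> where ns: "\<forall>k\<in>set ns. 2 \<le> k"
      and \<sigma>: "bij_betw \<sigma> (cycles_verts ns) (X - A)" and \<tau>: "bij_betw \<tau> (cycles_verts ns) (Y - B)"
      and rest: "E - A \<times> B = map_prod \<sigma> \<tau> ` cycles_rel ns"
      using psubset.IH reg by metis
    have "bij_betw (cycles_cons x \<sigma>) (cycles_verts (k # ns)) X"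
      "bij_betw (cycles_cons y \<tau>) (cycles_verts (k # ns)) Y"
      using bij_betw_cycles_cons[OF x \<sigma>] bij_betw_cycles_cons[OF y \<tau>] sub
      by (simp_all add: Un_absorb1)
    moreover have "E = map_prod (cycles_cons x \<sigma>) (cycles_cons y \<tau>) ` cycles_rel (k # ns)"
      unfolding map_prod_cycles_cons_cycles_rel cycle[symmetric] rest[symmetric] by blast
    ultimately show ?thesis
      using ns k by (intro exI[of _ "k # ns"]) auto
  qed
qed

section \<open>Zero-one matrices as relations\<close>

lemma ones_of_subset: "ones_of A \<subseteq> {..<dim_row A} \<times> {..<dim_col A}"
  by (auto simp: ones_of_def)

lemma zero_one_mat_index:
  assumes "zero_one_mat A" "i < dim_row A" "j < dim_col A"
  shows "A $$ (i, j) = of_bool ((i, j) \<in> ones_of A)"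
  using assms by (auto simp: zero_one_mat_def ones_of_def)

lemma ones_of_compl_mat:
  assumes "zero_one_mat A"
  shows "ones_of (compl_mat A) = {..<dim_row A} \<times> {..<dim_col A} - ones_of A"
proof -
  have "(i, j) \<in> ones_of (compl_mat A) \<longleftrightarrow>
      (i, j) \<in> {..<dim_row A} \<times> {..<dim_col A} - ones_of A" for i j
    using zero_one_mat_index[OF assms, of i j] by (auto simp: ones_of_def compl_mat_def)
  then show ?thesis
    by auto
qed

lemma perm_equiv_mat_ones_of:
  assumes "perm_equiv_mat A B"
  obtains p q where "p permutes {..<dim_row A}" "q permutes {..<dim_col A}"
    "ones_of B = map_prod p q ` ones_of A"
proof -
  obtain p q where p: "p permutes {..<dim_row B}" and q: "q permutes {..<dim_col B}"
    and A: "A = mat (dim_row B) (dim_col B) (\<lambda>(i, j). B $$ (p i, q j))"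
    using assms unfolding perm_equiv_mat_def by blast
  have dim: "dim_row A = dim_row B" "dim_col A = dim_col B"
    using assms by (simp_all add: perm_equiv_mat_def)
  have ones: "(p i, q j) \<in> ones_of B \<longleftrightarrow> (i, j) \<in> ones_of A" for i j
    using permutes_in_image[OF p, of i] permutes_in_image[OF q, of j] by (auto simp: A ones_of_def)
  have "ones_of B = map_prod p q ` ones_of A"
  proof (intro equalityI subsetI)
    fix e assume "e \<in> ones_of B"
    moreover obtain i j where "e = (p i, q j)"
      using permutes_surj[OF p] permutes_surj[OF q] by (metis prod.exhaust surjD)
    ultimately show "e \<in> map_prod p q ` ones_of A"
      using ones by force
  qed (use ones in auto)
  then show thesis
    using that p q dim by simp
qed

lemma perm_equiv_matI:
  assumes A: "A \<in> carrier_mat nr nc" "zero_one_mat A"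
    and B: "B \<in> carrier_mat nr nc" "zero_one_mat B"
    and p: "bij_betw p {..<nr} {..<nr}" and q: "bij_betw q {..<nc} {..<nc}"
    and ones: "ones_of B = map_prod p q ` ones_of A"
  shows "perm_equiv_mat A B"
proof -
  let ?p = "\<lambda>i. if i \<in> {..<nr} then p i else i" and ?q = "\<lambda>j. if j \<in> {..<nc} then q j else j"
  have "A = mat nr nc (\<lambda>(i, j). B $$ (?p i, ?q j))"
  proof (rule eq_matI)
    fix i j assume "i < dim_row (mat nr nc (\<lambda>(i, j). B $$ (?p i, ?q j)))"
      and "j < dim_col (mat nr nc (\<lambda>(i, j). B $$ (?p i, ?q j)))"
    then have ij: "i < nr" "j < nc"
      by simp_all
    have "inj_on (map_prod p q) ({..<nr} \<times> {..<nc})"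
      using p q by (auto simp: bij_betw_def intro: map_prod_inj_on)
    then have "map_prod p q (i, j) \<in> map_prod p q ` ones_of A \<longleftrightarrow> (i, j) \<in> ones_of A"
      using A(1) ij ones_of_subset[of A] by (intro inj_on_image_mem_iff) auto
    then have "A $$ (i, j) = of_bool ((p i, q j) \<in> ones_of B)"
      using A ij by (simp add: zero_one_mat_index ones)
    moreover have "p i < nr" "q j < nc"
      using bij_betwE[OF p] bij_betwE[OF q] ij by auto
    ultimately show "A $$ (i, j) = mat nr nc (\<lambda>(i, j). B $$ (?p i, ?q j)) $$ (i, j)"
      using B ij by (simp add: zero_one_mat_index)
  qed (use A in auto)
  moreover have "?p permutes {..<nr}"
    using p bij_betw_cong[of "{..<nr}" ?p p] by (intro bij_imp_permutes) simp_all
  moreover have "?q permutes {..<nc}"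
    using q bij_betw_cong[of "{..<nc}" ?q q] by (intro bij_imp_permutes) simp_all
  ultimately show ?thesis
    using A(1) B(1) unfolding perm_equiv_mat_def by blast
qed

lemma perm_equiv_compl_mat:
  assumes "perm_equiv_mat A B"
  shows "perm_equiv_mat (compl_mat A) (compl_mat B)"
proof -
  obtain p q where p: "p permutes {..<dim_row B}" and q: "q permutes {..<dim_col B}"
    and A: "A = mat (dim_row B) (dim_col B) (\<lambda>(i, j). B $$ (p i, q j))"
    using assms unfolding perm_equiv_mat_def by blast
  have "compl_mat A = mat (dim_row B) (dim_col B) (\<lambda>(i, j). compl_mat B $$ (p i, q j))"
    using permutes_in_image[OF p] permutes_in_image[OF q]
    by (intro eq_matI) (auto simp: A compl_mat_def)
  moreover have "dim_row (compl_mat B) = dim_row B" "dim_col (compl_mat B) = dim_col B"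
    by (simp_all add: compl_mat_def)
  ultimately show ?thesis
    using p q unfolding perm_equiv_mat_def by auto
qed

lemma binary_rank_perm_equiv_mat:
  assumes "perm_equiv_mat A B"
  shows "binary_rank A = binary_rank B"
proof -
  obtain p q where p: "p permutes {..<dim_row A}" and q: "q permutes {..<dim_col A}"
    and ones: "ones_of B = map_prod p q ` ones_of A"
    using assms by (rule perm_equiv_mat_ones_of)
  have "rect_rank (map_prod p q ` ones_of A) = rect_rank (ones_of A)"
    using p q by (intro rect_rank_map_prod[OF _ _ ones_of_subset] permutes_inj_on)
  then show ?thesis
    by (simp add: binary_rank_eq_rect_rank ones)
qed

section \<open>Circulant block diagonal matrices\<close>

lemma circ_mat_carrier: "circ_mat n k \<in> carrier_mat n n"
  by (simp add: circ_mat_def)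

lemma circ_block_diag2_carrier:
  "circ_block_diag2 ns \<in> carrier_mat (sum_list ns) (sum_list ns)"
  by (rule carrier_matI) (simp_all add: circ_block_diag2_def dim_diag_block_mat o_def circ_mat_def)

lemma circ_block_diag2_Cons:
  "circ_block_diag2 (k # ns) = four_block_mat (circ_mat k (k - 2)) (0\<^sub>m k (sum_list ns))
     (0\<^sub>m (sum_list ns) k) (circ_block_diag2 ns)"
  using carrier_matD[OF circ_block_diag2_carrier, of ns]
    carrier_matD[OF circ_mat_carrier, of k "k - 2"]
  by (simp add: circ_block_diag2_def Let_def)

lemma zero_one_mat_four_block_diag:
  assumes "zero_one_mat A" "zero_one_mat B"
  shows "zero_one_mat
    (four_block_mat A (0\<^sub>m (dim_row A) (dim_col B)) (0\<^sub>m (dim_row B) (dim_col A)) B)"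
  using assms by (auto simp: zero_one_mat_def)

lemma zero_one_mat_circ_block_diag2: "zero_one_mat (circ_block_diag2 ns)"
proof (induction ns)
  case Nil
  show ?case
    by (simp add: circ_block_diag2_def zero_one_mat_def)
next
  case (Cons k ns)
  have "zero_one_mat (circ_mat k (k - 2))"
    by (simp add: circ_mat_def zero_one_mat_def)
  then show ?case
    using zero_one_mat_four_block_diag[OF _ Cons, of "circ_mat k (k - 2)"]
      circ_mat_carrier[of k "k - 2"] circ_block_diag2_carrier[of ns]
    by (simp add: circ_block_diag2_Cons carrier_matD)
qed

lemma ones_of_four_block_diag:
  "ones_of (four_block_mat A (0\<^sub>m (dim_row A) (dim_col B)) (0\<^sub>m (dim_row B) (dim_col A)) B) =
     ones_of A \<union> map_prod ((+) (dim_row A)) ((+) (dim_col A)) ` ones_of B" (is "ones_of ?M = ?R")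
proof (intro equalityI subsetI)
  fix e assume e: "e \<in> ones_of ?M"
  obtain i j where ij: "e = (i, j)"
    by (cases e)
  show "e \<in> ?R"
  proof (cases "i < dim_row A \<and> j < dim_col A")
    case True
    then show ?thesis
      using e ij by (simp add: ones_of_def)
  next
    case False
    then have "(i - dim_row A, j - dim_col A) \<in> ones_of B" "dim_row A \<le> i" "dim_col A \<le> j"
      using e ij by (auto simp: ones_of_def split: if_splits)
    then show ?thesis
      unfolding ij by (intro UnI2 image_eqI[of _ _ "(i - dim_row A, j - dim_col A)"]) auto
  qed
qed (auto simp: ones_of_def)

lemma ones_of_circ_mat_two:
  assumes "2 \<le> k"
  shows "ones_of (circ_mat k (k - 2)) = cycle_rel k"
proof -
  have "(k + j - i) mod k < 2 \<longleftrightarrow> j = i \<or> j = Suc i mod k" if "i < k" "j < k" for i j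
  proof (cases "i \<le> j")
    case True
    then have "(k + j - i) mod k = j - i"
      using that by (simp add: mod_if)
    then show ?thesis
      using True that by (auto simp: mod_Suc)
  qed (use that in \<open>auto simp: mod_Suc\<close>)
  then show ?thesis
    using assms by (auto simp: ones_of_def circ_mat_def cycle_rel_def split: if_splits)
qed

definition cycles_pos :: "nat list \<Rightarrow> nat \<times> nat \<Rightarrow> nat" where
  "cycles_pos ns v = sum_list (take (fst v) ns) + snd v"

lemma cycles_pos_Cons: "cycles_pos (k # ns) = cycles_cons id ((+) k \<circ> cycles_pos ns)"
proof
  show "cycles_pos (k # ns) v = cycles_cons id ((+) k \<circ> cycles_pos ns) v" for v
    by (cases v; cases "fst v") (auto simp: cycles_pos_def)
qed

lemma bij_betw_cycles_pos: "bij_betw (cycles_pos ns) (cycles_verts ns) {..<sum_list ns}"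
proof (induction ns)
  case Nil
  show ?case
    by (simp add: cycles_verts_def bij_betw_def)
next
  case (Cons k ns)
  have "bij_betw ((+) k) {..<sum_list ns} {k..<k + sum_list ns}"
    by (simp add: bij_betw_def lessThan_atLeast0 add.commute)
  from bij_betw_trans[OF Cons this]
  have "bij_betw (cycles_pos (k # ns)) (cycles_verts (k # ns)) ({..<k} \<union> {k..<k + sum_list ns})"
    unfolding cycles_pos_Cons by (intro bij_betw_cycles_cons bij_betw_id) auto
  also have "{..<k} \<union> {k..<k + sum_list ns} = {..<sum_list (k # ns)}"
    by auto
  finally show ?case .
qed

lemma ones_of_circ_block_diag2:
  assumes "\<forall>k\<in>set ns. 2 \<le> k"
  shows "ones_of (circ_block_diag2 ns) = map_prod (cycles_pos ns) (cycles_pos ns) ` cycles_rel ns"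
  using assms
proof (induction ns)
  case Nil
  show ?case
    by (simp add: circ_block_diag2_def ones_of_def cycles_rel_def cycles_verts_def)
next
  case (Cons k ns)
  have "ones_of (circ_block_diag2 (k # ns)) =
      cycle_rel k \<union> map_prod ((+) k) ((+) k) ` ones_of (circ_block_diag2 ns)"
    using ones_of_four_block_diag[of "circ_mat k (k - 2)" "circ_block_diag2 ns"] Cons.prems
      circ_mat_carrier[of k "k - 2"] circ_block_diag2_carrier[of ns]
    by (simp add: circ_block_diag2_Cons carrier_matD ones_of_circ_mat_two)
  then show ?case
    using Cons
    by (simp add: cycles_pos_Cons map_prod_cycles_cons_cycles_rel image_comp map_prod_compose map_prod.id)
qed

lemma binary_rank_circ_block_diag2:
  assumes "\<forall>k\<in>set ns. 2 \<le> k"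
  shows "binary_rank (circ_block_diag2 ns) + length (filter (\<lambda>k. k = 2) ns) = sum_list ns"
proof -
  have inj: "inj_on (cycles_pos ns) (cycles_verts ns)"
    using bij_betw_cycles_pos by (rule bij_betw_imp_inj_on)
  have "binary_rank (circ_block_diag2 ns) = rect_rank (cycles_rel ns)"
    unfolding binary_rank_eq_rect_rank ones_of_circ_block_diag2[OF assms]
    by (rule rect_rank_map_prod[OF inj inj cycles_rel_subset])
  then show ?thesis
    using rect_rank_cycles_rel[OF assms] by simp
qed

lemma binary_rank_compl_circ_block_diag2_eq_rect_rank:
  assumes "\<forall>k\<in>set ns. 2 \<le> k"
  shows "binary_rank (compl_mat (circ_block_diag2 ns)) = rect_rank (cycles_corel ns)"
proof -
  let ?f = "map_prod (cycles_pos ns) (cycles_pos ns)" and ?V = "cycles_verts ns"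
  have inj: "inj_on (cycles_pos ns) ?V" and surj: "cycles_pos ns ` ?V = {..<sum_list ns}"
    using bij_betw_cycles_pos[of ns] by (simp_all add: bij_betw_def)
  have "ones_of (compl_mat (circ_block_diag2 ns)) = ?f ` (?V \<times> ?V) - ?f ` cycles_rel ns"
    using carrier_matD[OF circ_block_diag2_carrier, of ns] surj
    by (simp add: ones_of_compl_mat zero_one_mat_circ_block_diag2 ones_of_circ_block_diag2[OF assms]
        map_prod_surj_on)
  also have "\<dots> = ?f ` cycles_corel ns"
    unfolding cycles_corel_def
    by (rule inj_on_image_set_diff[OF map_prod_inj_on[OF inj inj], symmetric])
      (simp_all add: cycles_rel_subset)
  finally show ?thesis
    unfolding binary_rank_eq_rect_rank
    by (simp add: rect_rank_map_prod[OF inj inj] cycles_corel_def)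
qed

lemma binary_rank_compl_circ_block_diag2:
  assumes ge2: "\<forall>k\<in>set ns. 2 \<le> k" and "sum_list ns \<noteq> 2"
  shows "binary_rank (compl_mat (circ_block_diag2 ns)) + length (filter even ns)
    \<in> {sum_list ns, sum_list ns + 1}"
proof -
  have "0 \<notin> set ns"
    using ge2 by auto
  then show ?thesis
    using rect_rank_cycles_corel_le[of ns] rect_rank_cycles_corel_ge[OF assms]
    by (auto simp: binary_rank_compl_circ_block_diag2_eq_rect_rank[OF ge2])
qed

lemma regular_mat_regular_rel:
  assumes "M \<in> carrier_mat n n" "regular_mat k M"
  shows "regular_rel k {..<n} {..<n} (ones_of M)"
proof -
  have "ones_of M `` {i} = {j. j < dim_col M \<and> M $$ (i, j) = 1}" if "i < n" for i
    using that assms(1) by (auto simp: ones_of_def)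
  moreover have "(ones_of M)\<inverse> `` {j} = {i. i < dim_row M \<and> M $$ (i, j) = 1}" if "j < n" for j
    using that assms(1) by (auto simp: ones_of_def)
  ultimately show ?thesis
    using assms ones_of_subset[of M] by (simp add: regular_rel_def regular_mat_def)
qed

lemma two_regular_mat_perm_equiv_circ_block_diag2:
  assumes M: "M \<in> carrier_mat n n" and reg: "regular_mat 2 M"
  obtains ns where "\<forall>k\<in>set ns. 2 \<le> k" "perm_equiv_mat M (circ_block_diag2 ns)"
proof -
  have "finite (ones_of M)"
    by (rule finite_subset[OF ones_of_subset]) simp
  then obtain ns \<sigma> \<tau> where ns: "\<forall>k\<in>set ns. 2 \<le> k"
    and \<sigma>: "bij_betw \<sigma> (cycles_verts ns) {..<n}" and \<tau>: "bij_betw \<tau> (cycles_verts ns) {..<n}"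
    and ones: "ones_of M = map_prod \<sigma> \<tau> ` cycles_rel ns"
    using two_regular_rel_cycles[OF _ regular_mat_regular_rel[OF assms]] by metis
  let ?V = "cycles_verts ns"
  let ?p = "cycles_pos ns \<circ> inv_into ?V \<sigma>" and ?q = "cycles_pos ns \<circ> inv_into ?V \<tau>"
  have n: "sum_list ns = n"
    using bij_betw_same_card[OF \<sigma>] by (simp add: card_cycles_verts)
  have "map_prod ?p ?q ` ones_of M = map_prod (cycles_pos ns) (cycles_pos ns) ` cycles_rel ns"
    unfolding ones image_image using \<sigma> \<tau> cycles_rel_subset[of ns]
    by (intro image_cong) (auto simp: bij_betw_def)
  then have "ones_of (circ_block_diag2 ns) = map_prod ?p ?q ` ones_of M"
    by (simp add: ones_of_circ_block_diag2[OF ns])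
  moreover have "bij_betw ?p {..<n} {..<n}" "bij_betw ?q {..<n} {..<n}"
    using bij_betw_cycles_pos[of ns] \<sigma> \<tau> unfolding n
    by (blast intro: bij_betw_trans bij_betw_inv_into)+
  ultimately have "perm_equiv_mat M (circ_block_diag2 ns)"
    using M reg circ_block_diag2_carrier[of ns] zero_one_mat_circ_block_diag2 n
    by (intro perm_equiv_matI[of M n n _ ?p ?q]) (simp_all add: regular_mat_def)
  then show thesis
    using that ns by blast
qed

lemma sum_list_perm_equiv_circ_block_diag2:
  assumes "M \<in> carrier_mat n n" "perm_equiv_mat M (circ_block_diag2 ns)"
  shows "sum_list ns = n"
  using assms carrier_matD[OF circ_block_diag2_carrier, of ns] by (auto simp: perm_equiv_mat_def)

lemma regular_mat_full_eq_ones: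
  assumes M: "M \<in> carrier_mat n n" and reg: "regular_mat n M"
  shows "M = mat n n (\<lambda>_. 1)"
proof (rule eq_matI)
  fix i j assume "i < dim_row (mat n n (\<lambda>_. 1 :: real))" "j < dim_col (mat n n (\<lambda>_. 1 :: real))"
  then have ij: "i < n" "j < n"
    by simp_all
  have "card {j. j < n \<and> M $$ (i, j) = 1} = card {..<n}"
    using M reg ij by (simp add: regular_mat_def)
  then have "{j. j < n \<and> M $$ (i, j) = 1} = {..<n}"
    by (intro card_subset_eq) auto
  then show "M $$ (i, j) = mat n n (\<lambda>_. 1) $$ (i, j)"
    using ij by auto
qed (use M in auto)

theorem theorem1p6:
  fixes M :: "real mat" and n :: nat
  assumes "n > 0" and "M \<in> carrier_mat n n" and "regular_mat 2 M"
  shows "(\<exists>ns. length ns \<ge> 1 \<and> (\<forall>k \<in> set ns. k \<ge> 2) \<and>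
            perm_equiv_mat M (circ_block_diag2 ns)) \<and>
         (\<forall>ns m\<^sub>2 m_even.
            length ns \<ge> 1 \<and> (\<forall>k \<in> set ns. k \<ge> 2) \<and>
            perm_equiv_mat M (circ_block_diag2 ns) \<and>
            m\<^sub>2 = card {i. i < length ns \<and> ns ! i = 2} \<and>
            m_even = card {i. i < length ns \<and> even (ns ! i)} \<and>
            M \<noteq> mat 2 2 (\<lambda>_. 1) \<longrightarrow>
              int (binary_rank M) = int n - int m\<^sub>2 \<and>
              int (binary_rank (compl_mat M)) \<in>
                {int n - int m_even, int n - int m_even + 1})"
proof -
  note n = sum_list_perm_equiv_circ_block_diag2[OF assms(2)]
  obtain ns where ns: "\<forall>k\<in>set ns. 2 \<le> k" "perm_equiv_mat M (circ_block_diag2 ns)"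
    using two_regular_mat_perm_equiv_circ_block_diag2[OF assms(2,3)] .
  moreover have "length ns \<ge> 1"
    using n[OF ns(2)] \<open>n > 0\<close> by (cases ns) auto
  moreover have "int (binary_rank M) = int n - int (card {i. i < length ns \<and> ns ! i = 2}) \<and>
      int (binary_rank (compl_mat M)) \<in> {int n - int (card {i. i < length ns \<and> even (ns ! i)}),
        int n - int (card {i. i < length ns \<and> even (ns ! i)}) + 1}"
    if ge2: "\<forall>k\<in>set ns. 2 \<le> k" and equiv: "perm_equiv_mat M (circ_block_diag2 ns)"
      and not_ones: "M \<noteq> mat 2 2 (\<lambda>_. 1)" for ns
  proof -
    have "sum_list ns \<noteq> 2"
      using n[OF equiv] regular_mat_full_eq_ones[of M n] assms(2,3) not_ones by auto
    then show ?thesis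
      using binary_rank_circ_block_diag2[OF ge2] binary_rank_compl_circ_block_diag2[OF ge2]
        binary_rank_perm_equiv_mat[OF equiv]
        binary_rank_perm_equiv_mat[OF perm_equiv_compl_mat[OF equiv]] n[OF equiv]
      by (auto simp: length_filter_conv_card)
  qed
  ultimately show ?thesis
    by blast
qed

end
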